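(* Let $F$ be an algebraically closed field of characteristic different from $2$, and let $\mathbf{A}$ be an axial Jordan algebra of dimension $n\le 4$ over $F$. Then, for any set $X$ of generating axes of $\mathbf{A}$, every $\mathcal{J}(\frac12)$-axial non-split central extension of $(\mathbf{A},X)$ is a Jordan algebra.
   Context: A Jordan algebra is a commutative algebra satisfying $(xy)x^2=x(yx^2)$. Idempotents are understood to be nonzero. For an element $a$ of a commutative algebra $\mathbf{B}$: $L_a\colon y\mapsto ay$, $\mathrm{Spec}(a)$ is the set of eigenvalues of $L_a$, $\mathbf{B}^a_\lambda$ is the $\lambda$-eigenspace of $L_a$ (zero if $\lambda\notin \mathrm{Spec}(a)$), and $\mathbf{B}^a_S=\bigoplus_{\lambda\in S}\mathbf{B}^a_\lambda$, $\mathbf{B}^a_\emptyset=0$. The element $a$ is semisimple if every element of $\mathbf{B}$ lies in a finite-dimensional $L_a$-stable subspace and $L_a$ is diagonalisable on every finite-dimensional $L_a$-stable subspace. The fusion law $\mathcal{J}(\frac12)$ is the symmetric operation $\star$ from pairs of elements of $\{1,0,\frac12\}$ to subsets of $\{1,0,\frac12\}$ given by $1\star1=\{1\}$, $1\star0=\emptyset$, $1\star\frac12=\{\frac12\}$, $0\star0=\{0\}$, $0\star\frac12=\{\frac12\}$, $\frac12\star\frac12=\{1,0\}$. A $\mathcal{J}(\frac12)$-axis of $\mathbf{B}$ is a semisimple idempotent $a$ with $\mathrm{Spec}(a)\subseteq\{1,0,\frac12\}$ and $\mathbf{B}^a_\lambda\mathbf{B}^a_\mu\subseteq\mathbf{B}^a_{\lambda\star\mu}$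 for all $\lambda,\mu\in\mathrm{Spec}(a)$. A pair $(\mathbf{B},Y)$ is $\mathcal{J}(\frac12)$-axial if $\mathbf{B}$ is commutative and $Y$ is a finite set of $\mathcal{J}(\frac12)$-axes generating $\mathbf{B}$ as an algebra. Every idempotent of a Jordan algebra is a $\mathcal{J}(\frac12)$-axis (Peirce decomposition), so an axial Jordan algebra is a Jordan algebra generated by a finite set of idempotents, and a set of generating axes is a finite generating set of idempotents. For a vector space $V$ (of arbitrary dimension) and a bilinear map $\theta\colon\mathbf{A}\times\mathbf{A}\to V$, the central extension $\mathbf{A}_\theta$ is the vector space $\mathbf{A}\dotplus V$ with product $[x+v,y+w]_\theta=xy+\theta(x,y)$. It is split if $\mathbf{A}_\theta=I\oplus I'$ (direct sum of algebras) for an ideal $I$ and a nonzero subalgebra $I'$ of $\mathrm{Ann}(\mathbf{A}_\theta)$; otherwise non-split. A $\mathcal{J}(\frac12)$-axial central extension of $(\mathbf{A},X)$ is a central extension $\mathbf{A}_\theta$ (with $\theta$ symmetric) such that $(\mathbf{A}_\theta,\{a+\theta(a,a)\mid a\in X\})$ is $\mathcal{J}(\frac12)$-axial. *)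

theory Defs
  imports
    "HOL-Analysis.Product_Vector"
    "HOL-Computational_Algebra.Polynomial"
begin

section \<open>Algebras, not necessarily associative or unital\<close>

locale bilinear_map =
  s1: vector_space s1 + s2: vector_space s2 + s3: vector_space s3
  for s1 :: "'f::field \<Rightarrow> 'a::ab_group_add \<Rightarrow> 'a"
    and s2 :: "'f \<Rightarrow> 'b::ab_group_add \<Rightarrow> 'b"
    and s3 :: "'f \<Rightarrow> 'c::ab_group_add \<Rightarrow> 'c"
    and h :: "'a \<Rightarrow> 'b \<Rightarrow> 'c" +
  assumes linear_right: "Vector_Spaces.linear s2 s3 (\<lambda>y. h x y)"
    and linear_left: "Vector_Spaces.linear s1 s3 (\<lambda>x. h x y)"

text \<open>The underlying space of an algebra is a whole type; subalgebras, ideals and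
  eigenspaces are sets.\<close>

locale nonassoc_algebra =
  vector_space scale + mult: bilinear_map scale scale scale mult
  for scale :: "'f::field \<Rightarrow> 'b::ab_group_add \<Rightarrow> 'b" (infixr \<open>*s\<close> 75)
    and mult :: "'b \<Rightarrow> 'b \<Rightarrow> 'b" (infixl \<open>\<odot>\<close> 70)
begin

definition commutative :: bool
  where "commutative \<longleftrightarrow> (\<forall>x y. x \<odot> y = y \<odot> x)"

definition subalgebra :: "'b set \<Rightarrow> bool"
  where "subalgebra S \<longleftrightarrow> subspace S \<and> (\<forall>x\<in>S. \<forall>y\<in>S. x \<odot> y \<in> S)"

definition generates :: "'b set \<Rightarrow> bool"
  where "generates Y \<longleftrightarrow> subalgebra hull Y = UNIV"

definition alg_ideal :: "'b set \<Rightarrow> bool"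
  where "alg_ideal I \<longleftrightarrow> subspace I \<and> (\<forall>x\<in>I. \<forall>y. x \<odot> y \<in> I \<and> y \<odot> x \<in> I)"

definition Ann :: "'b set"
  where "Ann = {x. \<forall>y. x \<odot> y = 0 \<and> y \<odot> x = 0}"

definition direct_sum_decomp :: "'b set \<Rightarrow> 'b set \<Rightarrow> bool"
  where "direct_sum_decomp I J \<longleftrightarrow>
    subalgebra I \<and> subalgebra J \<and>
    (\<forall>x. \<exists>i\<in>I. \<exists>j\<in>J. x = i + j) \<and> I \<inter> J = {0} \<and>
    (\<forall>i\<in>I. \<forall>j\<in>J. i \<odot> j = 0 \<and> j \<odot> i = 0)"

definition finite_dim :: "'b set \<Rightarrow> bool"
  where "finite_dim U \<longleftrightarrow> subspace U \<and> (\<exists>B. finite B \<and> span B = U)"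

definition idempotent :: "'b \<Rightarrow> bool"
  where "idempotent a \<longleftrightarrow> a \<noteq> 0 \<and> a \<odot> a = a"


subsection \<open>Spectrum and semisimplicity of a multiplication operator\<close>

definition eigenspace :: "'b \<Rightarrow> 'f \<Rightarrow> 'b set"
  where "eigenspace a l = {x. a \<odot> x = l *s x}"

definition Spec :: "'b \<Rightarrow> 'f set"
  where "Spec a = {l. \<exists>x. x \<noteq> 0 \<and> a \<odot> x = l *s x}"

text \<open>The sum of eigenspaces for distinct eigenvalues is automatically direct.\<close>

definition eigenspaces :: "'b \<Rightarrow> 'f set \<Rightarrow> 'b set"
  where "eigenspaces a S = span (\<Union>l\<in>S. eigenspace a l)"

definition L_stable :: "'b \<Rightarrow> 'b set \<Rightarrow> bool"
  where "L_stable a U \<longleftrightarrow> (\<forall>x\<in>U. a \<odot> x \<in> U)"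

definition L_diagonalisable_on :: "'b \<Rightarrow> 'b set \<Rightarrow> bool"
  where "L_diagonalisable_on a U \<longleftrightarrow>
    (\<exists>B. independent B \<and> span B = U \<and> (\<forall>b\<in>B. \<exists>l. a \<odot> b = l *s b))"

definition semisimple :: "'b \<Rightarrow> bool"
  where "semisimple a \<longleftrightarrow>
    (\<forall>x. \<exists>U. finite_dim U \<and> L_stable a U \<and> x \<in> U) \<and>
    (\<forall>U. finite_dim U \<and> L_stable a U \<longrightarrow> L_diagonalisable_on a U)"

end


section \<open>Axes and axial algebras for the Jordan fusion law\<close>

text \<open>The law is a table on \<open>{1, 0, 1/2}\<close>, whose three elements are distinct
  when the characteristic is not 2. The values at other arguments are irrelevant.\<close>

definition fusion_J_half :: "'f::field \<Rightarrow> 'f \<Rightarrow> 'f set"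
  where "fusion_J_half l m =
    (if l = 1 \<and> m = 1 then {1}
     else if l = 0 \<and> m = 0 then {0}
     else if l = 1/2 \<and> m = 1/2 then {1, 0}
     else if {l, m} = {1, 1/2} \<or> {l, m} = {0, 1/2} then {1/2}
     else {})"

context nonassoc_algebra
begin

definition J_half_axis :: "'b \<Rightarrow> bool"
  where "J_half_axis a \<longleftrightarrow>
    semisimple a \<and> idempotent a \<and> Spec a \<subseteq> {1, 0, 1/2} \<and>
    (\<forall>l\<in>Spec a. \<forall>m\<in>Spec a. \<forall>x\<in>eigenspace a l. \<forall>y\<in>eigenspace a m.
       x \<odot> y \<in> eigenspaces a (fusion_J_half l m))"

definition J_half_axial :: "'b set \<Rightarrow> bool"
  where "J_half_axial Y \<longleftrightarrow>
    commutative \<and> finite Y \<and> (\<forall>a\<in>Y. J_half_axis a) \<and> generates Y"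

text \<open>For a Jordan algebra this is the same as \<open>J_half_axial\<close>: by the Peirce
  decomposition, all its idempotents are axes.\<close>

definition idempotent_generators :: "'b set \<Rightarrow> bool"
  where "idempotent_generators X \<longleftrightarrow> finite X \<and> (\<forall>a\<in>X. idempotent a) \<and> generates X"

end

locale jordan_algebra = nonassoc_algebra +
  assumes commutative: "commutative"
    and jordan_identity: "(x \<odot> y) \<odot> (x \<odot> x) = x \<odot> (y \<odot> (x \<odot> x))"

locale axial_jordan_algebra = jordan_algebra +
  assumes ex_idempotent_generators: "\<exists>X. idempotent_generators X"


section \<open>Central extensions\<close>

locale central_extension =
  A: nonassoc_algebra sA mA + theta: bilinear_map sA sA sV \<theta>
  for sA :: "'f::field \<Rightarrow> 'a::ab_group_add \<Rightarrow> 'a"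
    and mA :: "'a \<Rightarrow> 'a \<Rightarrow> 'a"
    and sV :: "'f \<Rightarrow> 'v::ab_group_add \<Rightarrow> 'v"
    and \<theta> :: "'a \<Rightarrow> 'a \<Rightarrow> 'v"
begin

definition ext_scale :: "'f \<Rightarrow> 'a \<times> 'v \<Rightarrow> 'a \<times> 'v"
  where "ext_scale = module_prod.scale sA sV"

definition ext_mult :: "'a \<times> 'v \<Rightarrow> 'a \<times> 'v \<Rightarrow> 'a \<times> 'v"
  where "ext_mult p q = (mA (fst p) (fst q), \<theta> (fst p) (fst q))"

sublocale prod: vector_space_prod sA sV ..

sublocale ext: nonassoc_algebra ext_scale ext_mult
proof -
  interpret E: vector_space ext_scale
    unfolding ext_scale_def by (rule prod.p.vector_space_axioms)
  have "Vector_Spaces.linear ext_scale ext_scale (ext_mult x)" for x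
  proof (intro Vector_Spaces.linear.intro module_hom.intro module_hom_axioms.intro
      E.vector_space_axioms E.module_axioms)
    interpret m: Vector_Spaces.linear sA sA "mA (fst x)" by (rule A.mult.linear_right)
    interpret t: Vector_Spaces.linear sA sV "\<theta> (fst x)" by (rule theta.linear_right)
    show "ext_mult x (p + q) = ext_mult x p + ext_mult x q" for p q
      by (simp add: ext_mult_def m.add t.add)
    show "ext_mult x (ext_scale r p) = ext_scale r (ext_mult x p)" for r p
      by (simp add: ext_mult_def ext_scale_def prod.scale_def m.scale t.scale)
  qed
  moreover have "Vector_Spaces.linear ext_scale ext_scale (\<lambda>x. ext_mult x y)" for y
  proof (intro Vector_Spaces.linear.intro module_hom.intro module_hom_axioms.intro
      E.vector_space_axioms E.module_axioms)
    interpret m: Vector_Spaces.linear sA sA "\<lambda>x. mA x (fst y)" by (rule A.mult.linear_left)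
    interpret t: Vector_Spaces.linear sA sV "\<lambda>x. \<theta> x (fst y)" by (rule theta.linear_left)
    show "ext_mult (p + q) y = ext_mult p y + ext_mult q y" for p q
      by (simp add: ext_mult_def m.add t.add)
    show "ext_mult (ext_scale r p) y = ext_scale r (ext_mult p y)" for r p
      by (simp add: ext_mult_def ext_scale_def prod.scale_def m.scale t.scale)
  qed
  ultimately show "nonassoc_algebra ext_scale ext_mult"
    by (intro nonassoc_algebra.intro bilinear_map.intro bilinear_map_axioms.intro
        E.vector_space_axioms)
qed

definition split :: bool
  where "split \<longleftrightarrow>
    (\<exists>I J. ext.alg_ideal I \<and> ext.subalgebra J \<and> J \<subseteq> ext.Ann \<and> J \<noteq> {0} \<and>
       ext.direct_sum_decomp I J)"

definition J_half_axial_ext :: "'a set \<Rightarrow> bool"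
  where "J_half_axial_ext X \<longleftrightarrow>
    (\<forall>x y. \<theta> x y = \<theta> y x) \<and> ext.J_half_axial ((\<lambda>a. (a, \<theta> a a)) ` X)"

end

end

theory Submission
  imports Defs
begin

text \<open>
  For a bilinear form \<open>t\<close> the Jordan identity has the two-argument defect
  \<open>t (x\<^sup>2 y) x - t (x\<^sup>2) (x y)\<close> and its linearisation. An idempotent \<open>b\<close> lifts to an axis of the
  extension only if the linearised defect of the cocycle vanishes whenever two of its four
  arguments are \<open>b\<close>. Composing with linear functionals, the cocycle may be taken scalar valued, and
  after subtracting a coboundary it is orthogonal for the Peirce decomposition \<open>E1 + Eh + E0\<close> of a
  generating idempotent \<open>a\<close>, with \<open>E1\<close> in its radical. It is then a Jordan cocycle as soon as
  \<open>E1\<close> acts on \<open>Eh\<close> by self-adjoint operators, \<open>t (h g) y = t (y h) g + t h (y g)\<close> for \<open>h\<close>, \<open>g\<close> in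
  \<open>Eh\<close> and \<open>y\<close> in \<open>E0\<close>, and the restriction to \<open>E0\<close> is a Jordan cocycle. With \<open>Eh \<noteq> 0\<close> and total
  dimension at most 4, these three conditions are non-trivial only for the Peirce dimensions
  (2, 2, 0), for (1, 2, 1) and one-dimensional \<open>Eh\<close>, and for (1, 1, 2) respectively; there they
  follow from the relations at the other generating axes. If \<open>Eh = 0\<close> for every generating axis, then the
  algebra is associative and the cocycle is associative as well.
\<close>

section \<open>The linearised Jordan identity\<close>

text \<open>The value type is free: \<open>t = m\<close> gives the Jordan identity of the algebra
  itself, \<open>t = \<theta>\<close> the \<open>V\<close>-component of that identity in the
  extension, and a functional applied to \<open>\<theta>\<close> a scalar form.\<close>

definition jordan_defect ::
    "('a \<Rightarrow> 'a \<Rightarrow> 'a) \<Rightarrow> ('a \<Rightarrow> 'a \<Rightarrow> 'c::ab_group_add) \<Rightarrow> 'a \<Rightarrow> 'a \<Rightarrow> 'c"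
  where "jordan_defect m t x y = t (m (m x x) y) x - t (m x x) (m x y)"

text \<open>For symmetric \<open>m\<close> and \<open>t\<close> this is half of the full
  linearisation of the defect in \<open>x\<close>. On the diagonal \<open>x = z = w\<close> it is
  three times the defect, so in characteristic 3 its vanishing says nothing about the defect
  there.\<close>

definition jordan_polar ::
    "('a \<Rightarrow> 'a \<Rightarrow> 'a) \<Rightarrow> ('a \<Rightarrow> 'a \<Rightarrow> 'c::ab_group_add) \<Rightarrow> 'a \<Rightarrow> 'a \<Rightarrow> 'a \<Rightarrow> 'a \<Rightarrow> 'c"
  where "jordan_polar m t x z w y =
    t (m (m x z) y) w + t (m (m z w) y) x + t (m (m w x) y) z
    - t (m x z) (m y w) - t (m z w) (m y x) - t (m w x) (m y z)"

locale symmetric_biadditive_pair =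
  fixes m :: "'a::ab_group_add \<Rightarrow> 'a \<Rightarrow> 'a" and t :: "'a \<Rightarrow> 'a \<Rightarrow> 'c::ab_group_add"
  assumes m_add: "m (x + y) z = m x z + m y z"
    and m_comm: "m x y = m y x"
    and t_add: "t (x + y) z = t x z + t y z"
    and t_comm: "t x y = t y x"
begin

lemma m_add_right: "m z (x + y) = m z x + m z y"
  by (metis m_add m_comm)

lemma t_add_right: "t z (x + y) = t z x + t z y"
  by (metis t_add t_comm)

lemma m_zero: "m 0 x = 0"
  using m_add[of 0 0 x] by simp

lemma t_zero: "t 0 x = 0"
  using t_add[of 0 0 x] by simp

lemma m_minus: "m (- x) z = - m x z"
  using m_add[of x "- x" z] m_zero[of z] by (simp add: eq_neg_iff_add_eq_0 add.commute)

lemma t_minus: "t (- x) z = - t x z"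
  using t_add[of x "- x" z] t_zero[of z] by (simp add: eq_neg_iff_add_eq_0 add.commute)

lemma m_minus_right: "m z (- x) = - m z x"
  by (metis m_minus m_comm)

lemma t_minus_right: "t z (- x) = - t z x"
  by (metis t_minus t_comm)

lemmas biadditive = m_add m_add_right t_add t_add_right m_minus m_minus_right t_minus t_minus_right

lemma defect_add:
  "jordan_defect m t (x + z) y =
    jordan_defect m t x y + jordan_polar m t x x z y + jordan_polar m t z z x y
    + jordan_defect m t z y"
  by (simp add: jordan_defect_def jordan_polar_def biadditive m_comm t_comm)

lemma polar_perm:
  "jordan_polar m t x z w y = jordan_polar m t z x w y"
  "jordan_polar m t x z w y = jordan_polar m t x w z y"
  by (simp_all add: jordan_polar_def m_comm t_comm)

lemma polar_add:
  "jordan_polar m t (x + x') z w y = jordan_polar m t x z w y + jordan_polar m t x' z w y"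
  "jordan_polar m t x (z + z') w y = jordan_polar m t x z w y + jordan_polar m t x z' w y"
  "jordan_polar m t x z (w + w') y = jordan_polar m t x z w y + jordan_polar m t x z w' y"
  "jordan_polar m t x z w (y + y') = jordan_polar m t x z w y + jordan_polar m t x z w y'"
  by (simp_all add: jordan_polar_def biadditive)

lemma polar_minus:
  "jordan_polar m t (- x) z w y = - jordan_polar m t x z w y"
  "jordan_polar m t x (- z) w y = - jordan_polar m t x z w y"
  "jordan_polar m t x z (- w) y = - jordan_polar m t x z w y"
  by (simp_all add: jordan_polar_def biadditive)

text \<open>The two mixed terms of \<open>defect_add\<close> have opposite parity in
  \<open>z\<close>, so replacing \<open>z\<close> by \<open>- z\<close> separates them. Polarising
  the repeated argument costs another factor 2.\<close>

lemma polar_eq_0: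
  assumes two: "\<And>v :: 'c. v + v = 0 \<Longrightarrow> v = 0"
    and defect: "\<And>x y. jordan_defect m t x y = 0"
  shows "jordan_polar m t x z w y = 0"
proof -
  have *: "jordan_polar m t x x z y + jordan_polar m t z z x y = 0" for x z
    using defect_add[of x z y] by (simp add: defect)
  have "jordan_polar m t z z x y = 0" for x z
    using *[of x z] *[of x "- z"] two[of "jordan_polar m t z z x y"]
    by (simp add: polar_minus)
  from this[of "x + z" w] this[of x w] this[of z w] show ?thesis
    using two[of "jordan_polar m t x z w y"] by (simp add: polar_add) (metis polar_perm)
qed

end

section \<open>Axes satisfy the linearised Jordan identity\<close>

lemma half_neq:
  assumes "(2::'f::field) \<noteq> 0"
  shows "(1/2::'f) \<noteq> 0" "(1/2::'f) \<noteq> 1" "(0::'f) \<noteq> 1/2" "(1::'f) \<noteq> 1/2"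
proof -
  have "(2::'f) \<noteq> 1" by (metis add_cancel_right_right one_add_one zero_neq_one)
  then show "(1/2::'f) \<noteq> 0" "(1/2::'f) \<noteq> 1" "(0::'f) \<noteq> 1/2" "(1::'f) \<noteq> 1/2"
    using assms by (auto simp: eq_divide_eq divide_eq_eq)
qed

lemma fusion_J_half_simps:
  assumes "(2::'f::field) \<noteq> 0"
  shows "fusion_J_half 1 1 = {1::'f}" "fusion_J_half 0 0 = {0::'f}"
    "fusion_J_half (1/2) (1/2) = {1, 0::'f}"
    "fusion_J_half 1 (1/2) = {1/2::'f}" "fusion_J_half 0 (1/2) = {1/2::'f}"
    "fusion_J_half 1 0 = ({}::'f set)" "fusion_J_half 0 1 = ({}::'f set)"
  unfolding fusion_J_half_def using half_neq[OF assms] by (auto simp: doubleton_eq_iff)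

context nonassoc_algebra
begin

lemma mult_add:
  "(x + y) \<odot> z = x \<odot> z + y \<odot> z" "z \<odot> (x + y) = z \<odot> x + z \<odot> y"
  using mult.linear_left mult.linear_right
  by (simp_all add: Vector_Spaces.linear_iff)

lemma mult_scale: "(c *s x) \<odot> z = c *s (x \<odot> z)" "z \<odot> (c *s x) = c *s (z \<odot> x)"
  using mult.linear_left mult.linear_right
  by (simp_all add: Vector_Spaces.linear_iff)

lemma mult_zero [simp]: "0 \<odot> x = 0" "x \<odot> 0 = 0"
  using mult_scale[where c = 0 and x = 0 and z = x] by simp_all

lemma mult_minus: "(- x) \<odot> z = - (x \<odot> z)" "z \<odot> (- x) = - (z \<odot> x)"
  using mult_scale[where c = "- 1"] by simp_all

lemma mult_diff:
  "(x - y) \<odot> z = x \<odot> z - y \<odot> z" "z \<odot> (x - y) = z \<odot> x - z \<odot> y"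
  using mult_add[where x = x and y = "- y"] by (simp_all add: mult_minus)

lemmas mult_bilinear = mult_add mult_scale mult_minus mult_diff

lemma subspace_eigenspace: "subspace (eigenspace a l)"
  by (auto simp: subspace_def eigenspace_def mult_bilinear scale_right_distrib scale_left_commute)

lemma eigenspaces_subset: "\<lbrakk>\<And>l. l \<in> S \<Longrightarrow> eigenspace a l \<subseteq> U; subspace U\<rbrakk> \<Longrightarrow> eigenspaces a S \<subseteq> U"
  unfolding eigenspaces_def by (intro span_minimal) auto

text \<open>The extension may be infinite-dimensional, so diagonalisability is applied on a
  finite-dimensional stable subspace containing \<open>x\<close>.\<close>

lemma J_half_axis_span:
  assumes "J_half_axis a"
  shows "x \<in> span (\<Union>l\<in>{1, 0, 1/2}. eigenspace a l)"
proof -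
  obtain U where U: "finite_dim U" "L_stable a U" "x \<in> U"
    using assms unfolding J_half_axis_def semisimple_def by meson
  then obtain B where B: "independent B" "span B = U" "\<forall>b\<in>B. \<exists>l. a \<odot> b = l *s b"
    using assms unfolding J_half_axis_def semisimple_def L_diagonalisable_on_def by meson
  have "B \<subseteq> (\<Union>l\<in>{1, 0, 1/2}. eigenspace a l)"
  proof
    fix b assume b: "b \<in> B"
    then obtain l where l: "a \<odot> b = l *s b" using B by auto
    have "b \<noteq> 0" using B b dependent_zero by blast
    then have "l \<in> Spec a" using l unfolding Spec_def by blast
    then have "l \<in> {1, 0, 1/2}" using assms unfolding J_half_axis_def by blast
    then show "b \<in> (\<Union>l\<in>{1, 0, 1/2}. eigenspace a l)"
      using l unfolding eigenspace_def by blast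
  qed
  then show ?thesis using U B span_mono by blast
qed

text \<open>Values outside \<open>Spec a\<close> have zero eigenspace, so the fusion rules hold for
  all three values whatever the spectrum is.\<close>

lemma J_half_axis_fusion:
  assumes "J_half_axis a" "l \<in> {1, 0, 1/2}" "m \<in> {1, 0, 1/2}" "x \<in> eigenspace a l" "y \<in> eigenspace a m"
  shows "x \<odot> y \<in> eigenspaces a (fusion_J_half l m)"
proof (cases "x = 0 \<or> y = 0")
  case True
  then show ?thesis by (auto simp: eigenspaces_def span_zero)
next
  case False
  then have "l \<in> Spec a" "m \<in> Spec a" using assms by (auto simp: Spec_def eigenspace_def)
  then show ?thesis using assms unfolding J_half_axis_def by blast
qed

text \<open>The fusion rules become equations for \<open>L_a\<close>. The sum of the eigenspaces for
  1 and 0 lies in the kernel of \<open>L_a^2 - L_a\<close>, whence the form of the second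
  one.\<close>

lemma J_half_axis_mult:
  assumes "J_half_axis a" "(2::'f) \<noteq> 0" "commutative"
    and "l \<in> {1, 0, 1/2}" "m \<in> {1, 0, 1/2}" "a \<odot> x = l *s x" "a \<odot> y = m *s y"
  shows "l = m \<Longrightarrow> l \<noteq> 1/2 \<Longrightarrow> a \<odot> (x \<odot> y) = l *s (x \<odot> y)"
    and "l = 1/2 \<Longrightarrow> m = 1/2 \<Longrightarrow> a \<odot> (a \<odot> (x \<odot> y)) = a \<odot> (x \<odot> y)"
    and "l \<noteq> 1/2 \<Longrightarrow> m = 1/2 \<Longrightarrow> a \<odot> (x \<odot> y) = (1/2) *s (x \<odot> y)"
    and "l \<noteq> 1/2 \<Longrightarrow> m \<noteq> 1/2 \<Longrightarrow> l \<noteq> m \<Longrightarrow> x \<odot> y = 0"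
proof -
  note ne = half_neq[OF assms(2)] and fus = fusion_J_half_simps[OF assms(2)]
  have xy: "x \<odot> y \<in> eigenspaces a (fusion_J_half l m)"
    using assms by (intro J_half_axis_fusion) (auto simp: eigenspace_def)
  have sub: "eigenspaces a {r} \<subseteq> eigenspace a r" for r
    by (rule eigenspaces_subset) (auto intro: subspace_eigenspace)
  have "subspace {z. a \<odot> (a \<odot> z) = a \<odot> z}"
    by (auto simp: subspace_def mult_bilinear)
  then have sub10: "eigenspaces a {1, 0} \<subseteq> {z. a \<odot> (a \<odot> z) = a \<odot> z}"
    by (intro eigenspaces_subset) (auto simp: eigenspace_def)
  show "a \<odot> (x \<odot> y) = l *s (x \<odot> y)" if "l = m" "l \<noteq> 1/2"
    using that assms(4) xy sub[of l] fus by (auto simp: eigenspace_def)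
  show "a \<odot> (a \<odot> (x \<odot> y)) = a \<odot> (x \<odot> y)" if "l = 1/2" "m = 1/2"
    using subsetD[OF sub10] xy unfolding that fus(3) by blast
  show "a \<odot> (x \<odot> y) = (1/2) *s (x \<odot> y)" if "l \<noteq> 1/2" "m = 1/2"
  proof -
    have "l = 1 \<or> l = 0" using that assms(4) by blast
    then have "x \<odot> y \<in> eigenspaces a {1/2}"
      using xy fus(4,5) unfolding that(2) by metis
    then show ?thesis using sub unfolding eigenspace_def by blast
  qed
  show "x \<odot> y = 0" if "l \<noteq> 1/2" "m \<noteq> 1/2" "l \<noteq> m"
    using that assms(4,5) xy fus by (auto simp: eigenspaces_def)
qed

lemma symmetric_biadditive_pair_mult:
  "commutative \<Longrightarrow> symmetric_biadditive_pair (\<odot>) (\<odot>)"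
  unfolding commutative_def by unfold_locales (auto simp: mult_bilinear)

lemma jordan_polar_scale:
  "jordan_polar (\<odot>) (\<odot>) (c *s x) z w y = c *s jordan_polar (\<odot>) (\<odot>) x z w y"
  "jordan_polar (\<odot>) (\<odot>) x (c *s z) w y = c *s jordan_polar (\<odot>) (\<odot>) x z w y"
  "jordan_polar (\<odot>) (\<odot>) x z (c *s w) y = c *s jordan_polar (\<odot>) (\<odot>) x z w y"
  "jordan_polar (\<odot>) (\<odot>) x z w (c *s y) = c *s jordan_polar (\<odot>) (\<odot>) x z w y"
  by (simp_all add: jordan_polar_def mult_bilinear scale_right_distrib scale_right_diff_distrib)

text \<open>On eigenvectors the polarised identity is a polynomial in \<open>L_a\<close> applied to
  a product: \<open>(2l - 1)(L_a - m)\<close> in the first case,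
  \<open>(l - m)^2 + L_a^2 - L_a\<close> in the second. The formulas serve axes, where fusion is
  known, and Jordan algebras, where the polar form is known to vanish.\<close>

lemma idempotent_polar:
  assumes "commutative" "a \<odot> a = a"
  shows "\<lbrakk>a \<odot> w = l *s w; a \<odot> y = m *s y\<rbrakk> \<Longrightarrow> jordan_polar (\<odot>) (\<odot>) a a w y =
      l *s (a \<odot> (w \<odot> y) - m *s (w \<odot> y)) + l *s (a \<odot> (w \<odot> y) - m *s (w \<odot> y))
      - (a \<odot> (w \<odot> y) - m *s (w \<odot> y))"
    and "\<lbrakk>a \<odot> z = l *s z; a \<odot> w = m *s w\<rbrakk> \<Longrightarrow> jordan_polar (\<odot>) (\<odot>) a z w a =
      ((l - m) * (l - m)) *s (z \<odot> w) + a \<odot> (a \<odot> (z \<odot> w)) - a \<odot> (z \<odot> w)"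
    and "\<lbrakk>a \<odot> z = l *s z; a \<odot> w = m *s w; a \<odot> y = n *s y\<rbrakk> \<Longrightarrow>
      jordan_polar (\<odot>) (\<odot>) a z w y =
        (l - m) *s (z \<odot> y \<odot> w - z \<odot> (y \<odot> w)) + a \<odot> (z \<odot> w \<odot> y) - n *s (z \<odot> w \<odot> y)"
proof -
  have comm: "x \<odot> y = y \<odot> x" for x y
    using assms(1) by (simp add: commutative_def)
  show "jordan_polar (\<odot>) (\<odot>) a a w y =
      l *s (a \<odot> (w \<odot> y) - m *s (w \<odot> y)) + l *s (a \<odot> (w \<odot> y) - m *s (w \<odot> y))
      - (a \<odot> (w \<odot> y) - m *s (w \<odot> y))"
    if "a \<odot> w = l *s w" "a \<odot> y = m *s y"
    by (simp add: jordan_polar_def assms(2) that that[unfolded comm[of a]] comm mult_bilinear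
        scale_right_diff_distrib algebra_simps)
  show "jordan_polar (\<odot>) (\<odot>) a z w a =
      ((l - m) * (l - m)) *s (z \<odot> w) + a \<odot> (a \<odot> (z \<odot> w)) - a \<odot> (z \<odot> w)"
    if "a \<odot> z = l *s z" "a \<odot> w = m *s w"
  proof -
    have "(l - m) * (l - m) = l * l - l * m - l * m + m * m"
      by (simp add: algebra_simps)
    then have "((l - m) * (l - m)) *s (z \<odot> w) =
        (l * l) *s (z \<odot> w) - (l * m) *s (z \<odot> w) - (l * m) *s (z \<odot> w) + (m * m) *s (z \<odot> w)"
      by (simp only: scale_left_distrib scale_left_diff_distrib)
    then show ?thesis
      by (simp add: jordan_polar_def assms(2) that that[unfolded comm[of a]] comm mult_bilinear
          algebra_simps)
  qed
  show "jordan_polar (\<odot>) (\<odot>) a z w y =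
        (l - m) *s (z \<odot> y \<odot> w - z \<odot> (y \<odot> w)) + a \<odot> (z \<odot> w \<odot> y) - n *s (z \<odot> w \<odot> y)"
    if "a \<odot> z = l *s z" "a \<odot> w = m *s w" "a \<odot> y = n *s y"
    by (simp add: jordan_polar_def that that[unfolded comm[of a]] comm mult_bilinear
        scale_right_diff_distrib algebra_simps)
qed

text \<open>By bilinearity eigenvectors suffice. In the first polynomial either
  \<open>2l - 1\<close> is zero or fusion puts the product into the \<open>m\<close>-eigenspace. The
  second vanishes on the product for each entry of the fusion table.\<close>

lemma J_half_axis_polar_eq_0:
  assumes a: "J_half_axis a" and two: "(2::'f) \<noteq> 0" and c: "commutative"
  shows "jordan_polar (\<odot>) (\<odot>) a a w y = 0" "jordan_polar (\<odot>) (\<odot>) a z w a = 0"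
proof -
  interpret P: symmetric_biadditive_pair "(\<odot>)" "(\<odot>)"
    by (rule symmetric_biadditive_pair_mult[OF c])
  let ?E = "\<Union>l\<in>{1, 0, 1/2}. eigenspace a l"
  note ne = half_neq[OF two]
  have half: "(1/2::'f) + 1/2 = 1"
    using two by (simp add: field_simps)
  have comm: "x \<odot> y = y \<odot> x" for x y
    using c by (simp add: commutative_def)
  have idem: "a \<odot> a = a"
    using a by (simp add: J_half_axis_def idempotent_def)
  have span: "x \<in> span ?E" for x
    by (rule J_half_axis_span[OF a])
  have bi: "P w y" if eigen: "\<And>w y. w \<in> ?E \<Longrightarrow> y \<in> ?E \<Longrightarrow> P w y"
    and sub: "\<And>w. subspace {y. P w y}" "\<And>y. subspace {w. P w y}" for P w y
  proof -
    have 1: "P w y" if "w \<in> ?E" for w y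
      using span_minimal[of ?E "{y. P w y}"] span[of y] eigen[OF that] sub(1)[of w] by blast
    show ?thesis
      using span_minimal[of ?E "{w. P w y}"] span[of w] 1 sub(2)[of y] by blast
  qed
  note polar1 = idempotent_polar(1)[OF c idem] and polar2 = idempotent_polar(2)[OF c idem]
  have halves: "(1/2) *s v + (1/2) *s v = v" for v
    by (metis half scale_left_distrib scale_one)
  have quarters: "((1/2 - l) * (1/2 - l)) *s v + (1/2) *s ((1/2) *s v) = (1/2) *s v"
      "((l - 1/2) * (l - 1/2)) *s v + (1/2) *s ((1/2) *s v) = (1/2) *s v"
    if "l = 0 \<or> l = 1" for v and l :: 'f
  proof -
    \<comment> \<open>One half is replaced by a variable with \<open>h + h = 1\<close>, which makes
      the claim polynomial.\<close>
    have "(h - l) * (h - l) + h * h = h" if "h + h = 1" for h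
      using that \<open>l = 0 \<or> l = 1\<close> by (elim disjE) algebra+
    from this[OF half] have "(1/2 - l) * (1/2 - l) + 1/2 * (1/2) = (1/2 :: 'f)" .
    moreover have "(l - 1/2) * (l - 1/2) = (1/2 - l) * (1/2 - l)"
      by (simp add: algebra_simps)
    ultimately show "((1/2 - l) * (1/2 - l)) *s v + (1/2) *s ((1/2) *s v) = (1/2) *s v"
      "((l - 1/2) * (l - 1/2)) *s v + (1/2) *s ((1/2) *s v) = (1/2) *s v"
      by (metis scale_left_distrib scale_scale)+
  qed
  show "jordan_polar (\<odot>) (\<odot>) a a w y = 0"
  proof (rule bi[where P = "\<lambda>w y. jordan_polar (\<odot>) (\<odot>) a a w y = 0"])
    fix w y assume "w \<in> ?E" "y \<in> ?E"
    then obtain l m where lm: "l \<in> {1, 0, 1/2}" "m \<in> {1, 0, 1/2}" "a \<odot> w = l *s w" "a \<odot> y = m *s y"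
      unfolding eigenspace_def by blast
    note F = J_half_axis_mult[OF a two c lm]
    have *: "a \<odot> (w \<odot> y) - m *s (w \<odot> y) = 0" if "l \<noteq> 1/2"
      using F(1)[OF _ that] F(3)[OF that] F(4)[OF that] by (cases "m = 1/2"; cases "l = m") auto
    show "jordan_polar (\<odot>) (\<odot>) a a w y = 0"
    proof (cases "l = 1/2")
      case True
      show ?thesis unfolding polar1[OF lm(3,4)] True halves by simp
    next
      case False
      show ?thesis unfolding polar1[OF lm(3,4)] *[OF False] by simp
    qed
  qed (auto simp: subspace_def P.polar_add jordan_polar_scale; simp add: jordan_polar_def)+
  show "jordan_polar (\<odot>) (\<odot>) a z w a = 0"
  proof (rule bi[where P = "\<lambda>z w. jordan_polar (\<odot>) (\<odot>) a z w a = 0"])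
    fix z w assume "z \<in> ?E" "w \<in> ?E"
    then obtain l m where lm: "l \<in> {1, 0, 1/2}" "m \<in> {1, 0, 1/2}" "a \<odot> z = l *s z" "a \<odot> w = m *s w"
      unfolding eigenspace_def by blast
    note F = J_half_axis_mult[OF a two c lm]
    note F' = J_half_axis_mult[OF a two c lm(2,1,4,3), unfolded comm[of w z]]
    consider "l = m" "l \<noteq> 1/2" | "l = 1/2" "m = 1/2" | "l \<noteq> 1/2" "m = 1/2"
      | "l = 1/2" "m \<noteq> 1/2" | "l \<noteq> 1/2" "m \<noteq> 1/2" "l \<noteq> m" by blast
    then show "jordan_polar (\<odot>) (\<odot>) a z w a = 0"
      unfolding polar2[OF lm(3,4)]
    proof cases
      case 1
      then have "l = 0 \<or> l = 1" using lm by blast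
      then show "((l - m) * (l - m)) *s (z \<odot> w) + a \<odot> (a \<odot> (z \<odot> w)) - a \<odot> (z \<odot> w) = 0"
        using F(1)[OF 1] 1 by auto
    next
      case 2
      show "((l - m) * (l - m)) *s (z \<odot> w) + a \<odot> (a \<odot> (z \<odot> w)) - a \<odot> (z \<odot> w) = 0"
        unfolding F(2)[OF 2] 2 by simp
    next
      case 3
      then have "l = 0 \<or> l = 1" using lm by blast
      then show "((l - m) * (l - m)) *s (z \<odot> w) + a \<odot> (a \<odot> (z \<odot> w)) - a \<odot> (z \<odot> w) = 0"
        unfolding F(3)[OF 3] mult_scale 3(2) using quarters(2) by auto
    next
      case 4
      then have "m = 0 \<or> m = 1" using lm by blast
      then show "((l - m) * (l - m)) *s (z \<odot> w) + a \<odot> (a \<odot> (z \<odot> w)) - a \<odot> (z \<odot> w) = 0"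
        unfolding F'(3)[OF 4(2,1)] mult_scale 4(1) using quarters(1) by auto
    next
      case 5
      then show "((l - m) * (l - m)) *s (z \<odot> w) + a \<odot> (a \<odot> (z \<odot> w)) - a \<odot> (z \<odot> w) = 0"
        using F(4)[OF 5] by auto
    qed
  qed (auto simp: subspace_def P.polar_add jordan_polar_scale; simp add: jordan_polar_def)+
qed

end

section \<open>Peirce decomposition of a Jordan algebra\<close>

text \<open>\<open>\<kappa>\<close> is one half; its existence encodes characteristic different from
  2. The element \<open>a\<close> may be 0, which later gives the linearised Jordan identity before
  an idempotent is chosen.\<close>

locale peirce_jordan_algebra = jordan_algebra scale mult
  for scale :: "'f::field \<Rightarrow> 'b::ab_group_add \<Rightarrow> 'b" (infixr \<open>*s\<close> 75)
    and mult :: "'b \<Rightarrow> 'b \<Rightarrow> 'b" (infixl \<open>\<odot>\<close> 70) +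
  fixes a :: 'b and \<kappa> :: 'f
  assumes half: "\<kappa> + \<kappa> = 1" and idem: "a \<odot> a = a"
begin

definition E1 where "E1 = {x. a \<odot> x = x}"
definition Eh where "Eh = {x. a \<odot> x = \<kappa> *s x}"
definition E0 where "E0 = {x. a \<odot> x = 0}"

lemma comm: "x \<odot> y = y \<odot> x"
  using commutative by (simp add: commutative_def)

lemma half_scale: "\<kappa> *s v + \<kappa> *s v = v"
  by (metis half scale_left_distrib scale_one)

lemma half_neq: "\<kappa> \<noteq> 0" "\<kappa> \<noteq> 1"
  using half by (auto, metis add_cancel_right_right zero_neq_one)

lemma one_minus_half: "1 - \<kappa> = \<kappa>"
  using half by (metis add_diff_cancel_right')

lemma double_eq_0: "v + v = 0 \<Longrightarrow> v = (0::'b)"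
  by (metis half_scale scale_right_distrib scale_zero_right)

lemma polar_mult_eq_0: "jordan_polar (\<odot>) (\<odot>) x z w y = 0"
proof -
  interpret P: symmetric_biadditive_pair "(\<odot>)" "(\<odot>)"
    by (rule symmetric_biadditive_pair_mult[OF commutative])
  have "jordan_defect (\<odot>) (\<odot>) x y = 0" for x y
    using jordan_identity[of x y] by (simp add: jordan_defect_def comm)
  then show ?thesis
    using P.polar_eq_0 double_eq_0 by blast
qed

section \<open>Peirce spaces and their multiplication rules\<close>

lemma subspace_E1: "subspace E1" and subspace_Eh: "subspace Eh" and subspace_E0: "subspace E0"
  by (auto simp: E1_def Eh_def E0_def subspace_def mult_bilinear scale_right_distrib
      scale_left_commute)

lemma a_E1: "a \<in> E1"
  by (simp add: E1_def idem)

lemma act_E1: "k \<in> E1 \<Longrightarrow> a \<odot> k = k" "k \<in> E1 \<Longrightarrow> k \<odot> a = k"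
  by (simp_all add: E1_def comm[of _ a])

lemma act_Eh: "h \<in> Eh \<Longrightarrow> a \<odot> h = \<kappa> *s h" "h \<in> Eh \<Longrightarrow> h \<odot> a = \<kappa> *s h"
  by (simp_all add: Eh_def comm[of _ a])

lemma act_E0: "y \<in> E0 \<Longrightarrow> a \<odot> y = 0" "y \<in> E0 \<Longrightarrow> y \<odot> a = 0"
  by (simp_all add: E0_def comm[of _ a])

lemmas act = act_E1 act_Eh act_E0

text \<open>For \<open>l = 0\<close> and \<open>l = 1\<close> the factor \<open>2l - 1\<close> is
  invertible, so the product inherits the eigenvalue of \<open>y\<close>. A product of
  \<open>E1\<close> with \<open>E0\<close> inherits both 1 and 0 and therefore vanishes.\<close>

lemma polar_a_a:
  assumes "a \<odot> w = l *s w" "a \<odot> y = m *s y" "l = 0 \<or> l = 1"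
  shows "a \<odot> (w \<odot> y) = m *s (w \<odot> y)"
  using idempotent_polar(1)[OF commutative idem assms(1,2)] assms(3)
  by (auto simp: polar_mult_eq_0)

lemma E1_E1: "k \<in> E1 \<Longrightarrow> k' \<in> E1 \<Longrightarrow> k \<odot> k' \<in> E1"
  using polar_a_a[of k 1 k' 1] by (simp add: E1_def)

lemma E0_E0: "y \<in> E0 \<Longrightarrow> y' \<in> E0 \<Longrightarrow> y \<odot> y' \<in> E0"
  using polar_a_a[of y 0 y' 0] by (simp add: E0_def)

lemma E1_E0: "k \<in> E1 \<Longrightarrow> y \<in> E0 \<Longrightarrow> k \<odot> y = 0" "k \<in> E1 \<Longrightarrow> y \<in> E0 \<Longrightarrow> y \<odot> k = 0"
  using polar_a_a[of k 1 y 0] polar_a_a[of y 0 k 1] by (simp_all add: E1_def E0_def comm[of y k])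

lemma E1_Eh: "k \<in> E1 \<Longrightarrow> h \<in> Eh \<Longrightarrow> k \<odot> h \<in> Eh" "k \<in> E1 \<Longrightarrow> h \<in> Eh \<Longrightarrow> h \<odot> k \<in> Eh"
  using polar_a_a[of k 1 h \<kappa>] by (simp_all add: E1_def Eh_def comm[of h k])

lemma E0_Eh: "y \<in> E0 \<Longrightarrow> h \<in> Eh \<Longrightarrow> y \<odot> h \<in> Eh" "y \<in> E0 \<Longrightarrow> h \<in> Eh \<Longrightarrow> h \<odot> y \<in> Eh"
  using polar_a_a[of y 0 h \<kappa>] by (simp_all add: E0_def Eh_def comm[of h y])

text \<open>For equal eigenvalues only \<open>L_a^2 = L_a\<close> is left of the second formula, so
  \<open>L_a\<close> itself projects the product onto its \<open>E1\<close> component.\<close>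

lemma Eh_Eh: assumes "h \<in> Eh" "h' \<in> Eh"
  shows "a \<odot> (h \<odot> h') \<in> E1" "h \<odot> h' - a \<odot> (h \<odot> h') \<in> E0"
proof -
  have "a \<odot> (a \<odot> (h \<odot> h')) = a \<odot> (h \<odot> h')"
    using idempotent_polar(2)[OF commutative idem, of h \<kappa> h' \<kappa>] assms
    by (simp add: polar_mult_eq_0 Eh_def)
  then show "a \<odot> (h \<odot> h') \<in> E1" "h \<odot> h' - a \<odot> (h \<odot> h') \<in> E0"
    by (simp_all add: E1_def E0_def mult_bilinear)
qed

lemmas fusion = E1_E1 E0_E0 E1_E0 E1_Eh E0_Eh

text \<open>The linearised identity at \<open>a\<close>, \<open>a\<close>, \<open>x\<close>,
  \<open>a\<close> says that \<open>L = L_a\<close> satisfies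
  \<open>L (2L - 1) (L - 1) = 0\<close>.\<close>

lemma peirce_decomposition:
  obtains k h y where "x = k + h + y" "k \<in> E1" "h \<in> Eh" "y \<in> E0"
proof -
  define u where "u = a \<odot> x"
  define v where "v = a \<odot> u"
  have "a \<odot> (a \<odot> (a \<odot> x)) + a \<odot> (a \<odot> (a \<odot> x)) + a \<odot> x =
      a \<odot> (a \<odot> x) + a \<odot> (a \<odot> x) + a \<odot> (a \<odot> x)"
    using polar_mult_eq_0[of a a x a] by (simp add: jordan_polar_def idem comm algebra_simps)
  then have w: "a \<odot> v + a \<odot> v + u = v + v + v"
    by (simp add: u_def v_def)
  define p where "p = u - v"
  \<comment> \<open>These are the interpolation polynomials \<open>L (2L - 1)\<close> and
    \<open>4 L (1 - L)\<close> for the eigenvalues 1 and 1/2, applied to \<open>x\<close>.\<close>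
  define k h where "k = v + v - u" and "h = (p + p) + (p + p)"
  have k: "a \<odot> k = k"
    using w by (simp add: k_def mult_bilinear v_def[symmetric]) (simp add: algebra_simps)
  have "a \<odot> p + a \<odot> p = p"
    using w by (simp add: p_def mult_bilinear v_def[symmetric]) (simp add: algebra_simps)
  then have ah: "a \<odot> h = p + p"
    by (simp only: h_def mult_add)
  then have "a \<odot> h + a \<odot> h = h"
    by (simp only: h_def)
  then have h: "a \<odot> h = \<kappa> *s h"
    by (metis half_scale scale_right_distrib)
  have "a \<odot> (x - k - h) = 0"
    by (simp add: mult_diff k ah u_def[symmetric]) (simp add: k_def p_def)
  then show ?thesis
    using that[of k h "x - k - h"] k h by (simp add: E1_def Eh_def E0_def)
qed

section \<open>Action of the outer Peirce spaces on \<open>Eh\<close>\<close>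

lemma polar_homogeneous:
  assumes "a \<odot> z = l *s z" "a \<odot> w = m *s w" "a \<odot> y = n *s y"
  shows "(l - m) *s (z \<odot> y \<odot> w - z \<odot> (y \<odot> w)) + a \<odot> (z \<odot> w \<odot> y) = n *s (z \<odot> w \<odot> y)"
  using idempotent_polar(3)[OF commutative idem assms] by (simp add: polar_mult_eq_0)

text \<open>Equivalently, sending \<open>k\<close> to twice its multiplication on \<open>Eh\<close>
  is a homomorphism into the endomorphisms of \<open>Eh\<close> with product
  \<open>(AB + BA)/2\<close>. The lemma after it is the same fact for \<open>E0\<close>.\<close>

lemma E1_mult_act:
  assumes "k \<in> E1" "k' \<in> E1" "h \<in> Eh"
  shows "k \<odot> k' \<odot> h = k \<odot> (k' \<odot> h) + k' \<odot> (k \<odot> h)"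
proof -
  have "\<kappa> *s (k \<odot> k' \<odot> h - k \<odot> (k' \<odot> h)) + \<kappa> *s (k \<odot> h \<odot> k') = k \<odot> h \<odot> k'"
    using polar_homogeneous[of k 1 h \<kappa> k' 1]
    by (simp add: one_minus_half assms fusion act)
  then have "k \<odot> k' \<odot> h - k \<odot> (k' \<odot> h) = k \<odot> h \<odot> k'"
    by (metis (no_types) half_scale add_right_cancel half_neq(1) scale_cancel_left)
  then show ?thesis by (simp add: algebra_simps comm[of "k \<odot> h"])
qed

lemma E0_mult_act:
  assumes "y \<in> E0" "y' \<in> E0" "h \<in> Eh"
  shows "y \<odot> y' \<odot> h = y \<odot> (y' \<odot> h) + y' \<odot> (y \<odot> h)"
proof -
  have "- (\<kappa> *s (y \<odot> y' \<odot> h - y \<odot> (y' \<odot> h))) + \<kappa> *s (y \<odot> h \<odot> y') = 0"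
    using polar_homogeneous[of y 0 h \<kappa> y' 0]
    by (simp add: assms fusion act)
  then have "\<kappa> *s (y \<odot> y' \<odot> h - y \<odot> (y' \<odot> h)) = \<kappa> *s (y \<odot> h \<odot> y')"
    by (metis add_eq_0_iff minus_minus)
  then have "y \<odot> y' \<odot> h - y \<odot> (y' \<odot> h) = y \<odot> h \<odot> y'"
    using half_neq(1) scale_cancel_left by blast
  then show ?thesis by (simp add: algebra_simps comm[of "y \<odot> h"])
qed

lemma E1_E0_act_commute:
  assumes "k \<in> E1" "y \<in> E0" "h \<in> Eh"
  shows "k \<odot> (y \<odot> h) = y \<odot> (k \<odot> h)"
proof -
  have "\<kappa> *s (- (k \<odot> (y \<odot> h))) + \<kappa> *s (k \<odot> h \<odot> y) = 0"
    using polar_homogeneous[of k 1 h \<kappa> y 0]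
    by (simp add: one_minus_half assms fusion act)
  then have "\<kappa> *s (k \<odot> h \<odot> y) = \<kappa> *s (k \<odot> (y \<odot> h))"
    by (metis add_eq_0_iff minus_minus scale_minus_right)
  then show ?thesis using half_neq(1) by (simp add: comm[of "k \<odot> h"])
qed

text \<open>The left side lies in \<open>E0\<close>. The two products on the right have equal
  \<open>E1\<close> components, and the subtracted term removes both.\<close>

lemma E0_act_Eh_Eh:
  assumes "y \<in> E0" "h \<in> Eh" "h' \<in> Eh"
  shows "y \<odot> (h \<odot> h') = y \<odot> h \<odot> h' + y \<odot> h' \<odot> h - (a \<odot> (y \<odot> h \<odot> h') + a \<odot> (y \<odot> h \<odot> h'))"
proof -
  have "- (\<kappa> *s (y \<odot> h' \<odot> h - y \<odot> (h' \<odot> h))) + a \<odot> (y \<odot> h \<odot> h') = \<kappa> *s (y \<odot> h \<odot> h')"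
    using polar_homogeneous[of y 0 h \<kappa> h' \<kappa>]
    by (simp add: assms fusion act)
  then have "\<kappa> *s (y \<odot> (h' \<odot> h)) = \<kappa> *s (y \<odot> h \<odot> h') + \<kappa> *s (y \<odot> h' \<odot> h) - a \<odot> (y \<odot> h \<odot> h')"
    by (simp add: algebra_simps)
  then have "\<kappa> *s (y \<odot> (h' \<odot> h)) = \<kappa> *s (y \<odot> h \<odot> h' + y \<odot> h' \<odot> h
      - (a \<odot> (y \<odot> h \<odot> h') + a \<odot> (y \<odot> h \<odot> h')))"
    by (simp add: scale_right_distrib scale_right_diff_distrib half_scale)
  then show ?thesis using half_neq(1) by (simp add: comm[of h h'])
qed

text \<open>This is the Jordan identity for \<open>h\<close> and \<open>a\<close>. It says that the
  \<open>E1\<close> and \<open>E0\<close> components of \<open>h \<odot> h\<close> act in the same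
  way on \<open>h\<close>.\<close>

lemma Eh_cube:
  assumes "h \<in> Eh"
  shows "h \<odot> h \<odot> h = a \<odot> (h \<odot> h) \<odot> h + a \<odot> (h \<odot> h) \<odot> h"
proof -
  have "\<kappa> *s (h \<odot> (h \<odot> h)) = h \<odot> (a \<odot> (h \<odot> h))"
    using jordan_identity[of h a] act(4)[OF assms] by (simp add: mult_bilinear)
  then show ?thesis by (metis half_scale comm)
qed

section \<open>Directness of the decomposition and dimensions\<close>

lemma E1_Int_Eh: "x \<in> E1 \<Longrightarrow> x \<in> Eh \<Longrightarrow> x = 0"
  using half_neq(2) scale_cancel_right[of 1 x \<kappa>] by (simp add: E1_def Eh_def)

lemma E1_plus_Eh_Int_E0:
  assumes "k \<in> E1" "h \<in> Eh" "k + h \<in> E0"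
  shows "k = 0" "h = 0"
proof -
  have 1: "k + \<kappa> *s h = 0" using assms by (simp add: E1_def Eh_def E0_def mult_bilinear)
  then have "a \<odot> (k + \<kappa> *s h) = 0" by simp
  then have "k + \<kappa> *s \<kappa> *s h = 0" using assms by (simp add: E1_def Eh_def mult_bilinear)
  with 1 have "\<kappa> *s h = \<kappa> *s \<kappa> *s h" by (metis add_left_cancel)
  then have "h = \<kappa> *s h" using half_neq(1) scale_cancel_left by blast
  then show "h = 0" using half_neq(2) by (metis scale_one scale_cancel_right)
  with 1 show "k = 0" by simp
qed

end

locale fin_dim_peirce_jordan_algebra =
  peirce_jordan_algebra scale mult a \<kappa> + finite_dimensional_vector_space scale Basis
  for scale :: "'f::field \<Rightarrow> 'b::ab_group_add \<Rightarrow> 'b" (infixr \<open>*s\<close> 75)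
    and mult :: "'b \<Rightarrow> 'b \<Rightarrow> 'b" (infixl \<open>\<odot>\<close> 70) and a \<kappa> Basis
begin

lemma dim_peirce: "dim E1 + dim Eh + dim E0 = dim (UNIV :: 'b set)"
proof -
  let ?S = "{x + y |x y. x \<in> E1 \<and> y \<in> Eh}"
  let ?T = "{x + y |x y. x \<in> ?S \<and> y \<in> E0}"
  have "E1 \<inter> Eh = {0}"
    using E1_Int_Eh subspace_0[OF subspace_E1] subspace_0[OF subspace_Eh] by blast
  then have 1: "dim ?S = dim E1 + dim Eh"
    using dim_sums_Int[OF subspace_E1 subspace_Eh] by simp
  have sub: "subspace ?S"
    by (rule subspace_sums[OF subspace_E1 subspace_Eh])
  have "x = 0" if "x \<in> ?S" "x \<in> E0" for x
    using that E1_plus_Eh_Int_E0 by fastforce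
  then have "?S \<inter> E0 = {0}"
    using subspace_0[OF sub] subspace_0[OF subspace_E0] by blast
  then have "dim ?T = dim ?S + dim E0"
    using dim_sums_Int[OF sub subspace_E0] by simp
  moreover have all: "x \<in> ?T" for x
  proof -
    obtain k h y where "x = k + h + y" "k \<in> E1" "h \<in> Eh" "y \<in> E0"
      by (rule peirce_decomposition)
    then show ?thesis by blast
  qed
  moreover have "?T = UNIV" using all by (intro UNIV_eq_I[symmetric])
  ultimately show ?thesis using 1 by simp
qed

lemma dim_le_1:
  assumes "subspace S" "dim S \<le> 1" "x \<in> S" "x \<noteq> 0" "y \<in> S"
  obtains c where "y = c *s x"
proof -
  have "span {x} = S"
    using subspace_dim_equal[of "span {x}" S] assms span_minimal[of "{x}" S]
    by (simp add: dim_singleton)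
  then show ?thesis using that assms(5) by (auto simp: span_singleton)
qed

lemma dim_le_1_ex:
  assumes "subspace S" "dim S \<le> 1"
  obtains x where "x \<in> S" "\<And>y. y \<in> S \<Longrightarrow> \<exists>c. y = c *s x"
proof (cases "S \<subseteq> {0}")
  case True
  then show ?thesis using that[of 0] subspace_0[OF assms(1)] by auto
next
  case False
  then obtain x where x: "x \<in> S" "x \<noteq> 0" by auto
  have "\<exists>c. y = c *s x" if "y \<in> S" for y
    by (rule dim_le_1[OF assms x that]) blast
  then show ?thesis using that[of x] x(1) by blast
qed

lemma dim_le_2:
  assumes "subspace S" "dim S \<le> 2" "x \<in> S" "x \<noteq> 0" "y \<in> S" "\<And>c. y \<noteq> c *s x" "z \<in> S"
  obtains c d where "z = c *s x + d *s y"
proof -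
  have "y \<notin> span {x}" using assms(6) by (auto simp: span_singleton)
  then have "dim (span {x, y}) = 2"
    using dim_insert[of y "{x}"] assms(4) by (simp add: dim_singleton insert_commute)
  then have "span {x, y} = S"
    using subspace_dim_equal[of "span {x, y}" S] assms span_minimal[of "{x, y}" S] by auto
  then have "z \<in> span {y, x}" using assms(7) by (simp add: insert_commute)
  then obtain d where "z - d *s y \<in> span {x}" by (auto simp: span_insert)
  then obtain c where "z - d *s y = c *s x" by (auto simp: span_singleton)
  then show ?thesis using that[of c d] by (simp add: algebra_simps)
qed

lemma dim_le_1I: "(\<And>y. y \<in> S \<Longrightarrow> \<exists>c. y = c *s x) \<Longrightarrow> dim S \<le> 1"
  using dim_le_card[of S "{x}"] by (auto simp: span_singleton)

lemma subalgebra_span: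
  assumes "\<And>x y. x \<in> S \<Longrightarrow> y \<in> S \<Longrightarrow> x \<odot> y \<in> span S"
  shows "subalgebra (span S)"
proof -
  have 1: "x \<odot> y \<in> span S" if "x \<in> S" "y \<in> span S" for x y
  proof -
    have "span S \<subseteq> {y. x \<odot> y \<in> span S}"
      using assms[OF that(1)]
      by (intro span_minimal) (auto simp: subspace_def mult_bilinear span_add span_scale span_zero)
    then show ?thesis using that(2) by blast
  qed
  have "x \<odot> y \<in> span S" if "x \<in> span S" "y \<in> span S" for x y
  proof -
    have "span S \<subseteq> {x. x \<odot> y \<in> span S}"
      using 1[OF _ that(2)]
      by (intro span_minimal) (auto simp: subspace_def mult_bilinear span_add span_scale span_zero)
    then show ?thesis using that(1) by blast
  qed
  then show ?thesis by (simp add: subalgebra_def)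
qed

text \<open>Used for contradictions: in dimension 4 the generators cannot lie in a span of at most
  three elements that is closed under products.\<close>

lemma generates_dim_le:
  assumes "generates X" "X \<subseteq> span S" "finite S" "\<And>x y. x \<in> S \<Longrightarrow> y \<in> S \<Longrightarrow> x \<odot> y \<in> span S"
  shows "dim (UNIV :: 'b set) \<le> card S"
proof -
  have "subalgebra hull X \<subseteq> span S"
    by (rule hull_minimal[where S = subalgebra, OF assms(2) subalgebra_span[OF assms(4)]])
  then show ?thesis
    using assms(1,3) dim_le_card[of UNIV S] by (simp add: generates_def)
qed

end

section \<open>Normalised forms\<close>

locale peirce_form = peirce_jordan_algebra scale mult a \<kappa>
  for scale :: "'f::field \<Rightarrow> 'b::ab_group_add \<Rightarrow> 'b" (infixr \<open>*s\<close> 75)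
    and mult :: "'b \<Rightarrow> 'b \<Rightarrow> 'b" (infixl \<open>\<odot>\<close> 70) and a \<kappa> +
  fixes \<tau> :: "'b \<Rightarrow> 'b \<Rightarrow> 'f"
  assumes form_add: "\<tau> (x + y) z = \<tau> x z + \<tau> y z"
    and form_scale: "\<tau> (c *s x) z = c * \<tau> x z"
    and form_comm: "\<tau> x y = \<tau> y x"
    and form_a: "\<tau> a x = 0"
    and polar_a: "jordan_polar (\<odot>) \<tau> a a w y = 0"
begin

sublocale form: symmetric_biadditive_pair "(\<odot>)" \<tau>
  by unfold_locales (simp add: mult_bilinear, rule comm, rule form_add, rule form_comm)

lemma form_scale_right: "\<tau> x (c *s z) = c * \<tau> x z"
  by (metis form_scale form_comm)

lemma form_zero: "\<tau> 0 x = 0" "\<tau> x 0 = 0"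
  by (simp_all add: form.t_zero form_comm[of x])

lemma form_diff: "\<tau> (x - y) z = \<tau> x z - \<tau> y z" "\<tau> z (x - y) = \<tau> z x - \<tau> z y"
  using form.t_add[of x "- y" z] form.t_add_right[of z x "- y"]
  by (simp_all add: form.t_minus form.t_minus_right)

lemmas form_bilinear = form_add form.t_add_right form_scale form_scale_right form_diff form_zero
  form.t_minus form.t_minus_right

lemma form_a_right: "\<tau> x a = 0"
  by (simp add: form_comm[of x] form_a)

lemma two_neq: "(2::'f) \<noteq> 1" "(2::'f) \<noteq> 0"
  using half by (metis add_cancel_right_right one_add_one zero_neq_one,
    metis mult_2 mult_zero_left zero_neq_one)

text \<open>If \<open>w\<close> and \<open>y\<close> have eigenvalues \<open>l\<close> and
  \<open>m\<close>, this reads \<open>m (1 - 2l) \<tau> w y = 0\<close>. By symmetry only the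
  pairings inside \<open>Eh\<close> and inside \<open>E0\<close> survive.\<close>

lemma form_act: "\<tau> (a \<odot> y) w = \<tau> (a \<odot> w) (a \<odot> y) + \<tau> (a \<odot> w) (a \<odot> y)"
  using polar_a[of w y]
  by (simp add: jordan_polar_def idem comm form_a form_a_right form_comm algebra_simps)

lemma form_E1_E1: "x \<in> E1 \<Longrightarrow> y \<in> E1 \<Longrightarrow> \<tau> x y = 0"
  using form_act[of y x] two_neq by (simp add: act form_comm)

lemma form_E1_Eh: "x \<in> E1 \<Longrightarrow> y \<in> Eh \<Longrightarrow> \<tau> x y = 0"
proof -
  assume "x \<in> E1" "y \<in> Eh"
  then have "\<kappa> * \<tau> y x = \<kappa> * \<tau> y x + \<kappa> * \<tau> y x"
    using form_act[of y x] by (simp add: act form_bilinear form_comm[of x y])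
  then show ?thesis using half_neq two_neq by (simp add: form_comm)
qed

lemma form_E0: "y \<in> E0 \<Longrightarrow> x \<in> E1 \<Longrightarrow> \<tau> y x = 0" "y \<in> E0 \<Longrightarrow> x \<in> Eh \<Longrightarrow> \<tau> y x = 0"
  using form_act[of x y] half_neq by (simp_all add: act form_bilinear form_comm[of y x])

lemma form_E1:
  assumes "x \<in> E1" shows "\<tau> x z = 0" "\<tau> z x = 0"
proof -
  obtain k h y where "z = k + h + y" "k \<in> E1" "h \<in> Eh" "y \<in> E0"
    by (rule peirce_decomposition)
  then show "\<tau> x z = 0"
    using assms by (simp add: form_bilinear form_E1_E1 form_E1_Eh form_E0 form_comm[of x y])
  then show "\<tau> z x = 0" by (simp add: form_comm)
qed

lemma form_E0_Eh: "y \<in> E0 \<Longrightarrow> h \<in> Eh \<Longrightarrow> \<tau> y h = 0" "y \<in> E0 \<Longrightarrow> h \<in> Eh \<Longrightarrow> \<tau> h y = 0"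
  by (simp_all add: form_E0 form_comm[of h])

lemma form_Eh_Eh_Eh:
  assumes "h \<in> Eh" "h' \<in> Eh" "g \<in> Eh" shows "\<tau> (h \<odot> h') g = 0" "\<tau> g (h \<odot> h') = 0"
proof -
  have "\<tau> (a \<odot> (h \<odot> h')) g + \<tau> (h \<odot> h' - a \<odot> (h \<odot> h')) g = 0"
    using Eh_Eh[OF assms(1,2)] assms(3) form_E1 form_E0 by simp
  then show "\<tau> (h \<odot> h') g = 0" by (simp add: form_diff)
  then show "\<tau> g (h \<odot> h') = 0" by (simp add: form_comm)
qed

lemmas form_orth = form_E1 form_E0_Eh form_Eh_Eh_Eh

lemma Eh_Eh_Eh:
  assumes "h \<in> Eh" "h' \<in> Eh" "g \<in> Eh" shows "h \<odot> h' \<odot> g \<in> Eh"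
proof -
  have "a \<odot> (h \<odot> h') \<odot> g + (h \<odot> h' - a \<odot> (h \<odot> h')) \<odot> g \<in> Eh"
    using Eh_Eh[OF assms(1,2)] assms(3) fusion subspace_add[OF subspace_Eh] by simp
  then show ?thesis by (simp add: mult_diff)
qed

lemma form_split:
  assumes "k \<in> E1" "k' \<in> E1" "h \<in> Eh" "h' \<in> Eh" "y \<in> E0" "y' \<in> E0"
  shows "\<tau> (k + h + y) (k' + h' + y') = \<tau> h h' + \<tau> y y'"
  using assms by (simp add: form_bilinear form_orth)

text \<open>For \<open>y\<close> in \<open>E0\<close> and \<open>h\<close>, \<open>g\<close> in
  \<open>Eh\<close> this is, up to the factor \<open>\<kappa>\<close>, the polarised defect at
  \<open>a\<close>, \<open>h\<close>, \<open>y\<close>, \<open>g\<close>. With a single argument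
  \<open>a\<close> it is not covered by the relations at \<open>a\<close>, so other axes have to
  make it vanish.\<close>

definition H where "H y h g = \<tau> (h \<odot> g) y - \<tau> (y \<odot> h) g - \<tau> h (y \<odot> g)"

lemma H_bilinear:
  "H y (h + h') g = H y h g + H y h' g" "H y (c *s h) g = c * H y h g"
  "H y h (g + h') = H y h g + H y h h'" "H y h (c *s g) = c * H y h g"
  "H (c *s y) h g = c * H y h g" "H 0 h g = 0" "H y 0 g = 0"
  by (simp_all add: H_def mult_bilinear form_bilinear algebra_simps)

section \<open>Relations imposed by a second axis\<close>

lemma form_polar_a:
  assumes "a \<odot> z = l *s z" "a \<odot> w = m *s w" "a \<odot> y = n *s y"
  shows "jordan_polar (\<odot>) \<tau> a z w y = (l - m) * (\<tau> (z \<odot> y) w - \<tau> z (y \<odot> w)) - n * \<tau> (z \<odot> w) y"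
  by (simp add: jordan_polar_def form_bilinear mult_bilinear assms assms[unfolded comm[of a]]
      form_a form_a_right comm form_comm algebra_simps)

lemma form_polar_scale:
  "jordan_polar (\<odot>) \<tau> (c *s x) z w y = c * jordan_polar (\<odot>) \<tau> x z w y"
  "jordan_polar (\<odot>) \<tau> x (c *s z) w y = c * jordan_polar (\<odot>) \<tau> x z w y"
  "jordan_polar (\<odot>) \<tau> x z (c *s w) y = c * jordan_polar (\<odot>) \<tau> x z w y"
  by (simp_all add: jordan_polar_def mult_bilinear form_bilinear algebra_simps)

lemma scale_act: "k \<in> E1 \<Longrightarrow> a \<odot> k = 1 *s k" "h \<in> Eh \<Longrightarrow> a \<odot> h = \<kappa> *s h" "y \<in> E0 \<Longrightarrow> a \<odot> y = 0 *s y"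
  by (simp_all add: act)

lemmas form_polar_a_hom =
  form_polar_a[OF scale_act(1) scale_act(2) scale_act(1)]
  form_polar_a[OF scale_act(1) scale_act(2) scale_act(2)]
  form_polar_a[OF scale_act(1) scale_act(2) scale_act(3)]
  form_polar_a[OF scale_act(2) scale_act(2) scale_act(1)]
  form_polar_a[OF scale_act(2) scale_act(2) scale_act(2)]
  form_polar_a[OF scale_act(2) scale_act(2) scale_act(3)]
  form_polar_a[OF scale_act(3) scale_act(2) scale_act(1)]
  form_polar_a[OF scale_act(3) scale_act(2) scale_act(2)]
  form_polar_a[OF scale_act(3) scale_act(2) scale_act(3)]
  form_polar_a[OF scale_act(1) scale_act(3) scale_act(1)]
  form_polar_a[OF scale_act(1) scale_act(3) scale_act(2)]
  form_polar_a[OF scale_act(1) scale_act(3) scale_act(3)]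
  form_polar_a[OF scale_act(2) scale_act(3) scale_act(1)]
  form_polar_a[OF scale_act(2) scale_act(3) scale_act(2)]
  form_polar_a[OF scale_act(2) scale_act(3) scale_act(3)]
  form_polar_a[OF scale_act(3) scale_act(3) scale_act(1)]
  form_polar_a[OF scale_act(3) scale_act(3) scale_act(2)]
  form_polar_a[OF scale_act(3) scale_act(3) scale_act(3)]

text \<open>The relation at \<open>b\<close> is evaluated at \<open>a\<close>, where all homogeneous
  terms are explicit. Orthogonality leaves the failure of \<open>k\<close> to be self-adjoint,
  coupled with \<open>H\<close>.\<close>

lemma axis_relation_half:
  assumes b: "jordan_polar (\<odot>) \<tau> b a g b = 0"
    and "b = k + h + y" "k \<in> E1" "h \<in> Eh" "y \<in> E0" "g \<in> Eh"
  shows "\<tau> (k \<odot> h) g - \<tau> (k \<odot> g) h + H y h g = 0"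
proof -
  have "jordan_polar (\<odot>) \<tau> a (k + h + y) g (k + h + y) = 0"
    using b assms(2) form.polar_perm(1) by metis
  then have "\<kappa> * (\<tau> (k \<odot> h) g - \<tau> (k \<odot> g) h + H y h g) = 0"
    using assms(3-)
    by (simp add: form.polar_add form_polar_a_hom fusion form_orth form_zero one_minus_half H_def
        comm form_comm algebra_simps)
  then show ?thesis using half_neq by simp
qed

text \<open>Tested on \<open>E0\<close>, the same relation leaves just the diagonal of the symmetric
  form \<open>H w\<close>. This settles the case of one-dimensional \<open>Eh\<close>.\<close>

lemma axis_relation_zero:
  assumes b: "jordan_polar (\<odot>) \<tau> b a w b = 0"
    and "b = k + h + y" "k \<in> E1" "h \<in> Eh" "y \<in> E0" "w \<in> E0"
  shows "H w h h = 0"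
proof -
  have "jordan_polar (\<odot>) \<tau> a (k + h + y) w (k + h + y) = 0"
    using b assms(2) form.polar_perm(1) by metis
  then have "\<kappa> * H w h h = 0"
    using assms(3-)
    by (simp add: form.polar_add form_polar_a_hom fusion form_orth form_zero one_minus_half H_def
        comm form_comm algebra_simps)
  then show ?thesis using half_neq by simp
qed

text \<open>The terms quadratic in \<open>a\<close> or in \<open>h\<close> vanish, and the mixed
  term is a multiple of \<open>H\<close>. It covers axes without \<open>E0\<close>
  component.\<close>

lemma axis_relation_a_half:
  assumes b: "jordan_polar (\<odot>) \<tau> b b w g = 0"
    and "b = l *s a + h" "h \<in> Eh" "w \<in> E0" "g \<in> Eh"
  shows "l * H w h g = 0"
proof -
  have 1: "jordan_polar (\<odot>) \<tau> h h w g = 0"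
    using assms(3-) by (simp add: jordan_polar_def form_orth fusion Eh_Eh_Eh)
  have 2: "jordan_polar (\<odot>) \<tau> a h w g = \<kappa> * H w h g"
    using assms(3-)
    by (simp add: form_polar_a_hom H_def comm form_comm algebra_simps)
  have "l * (jordan_polar (\<odot>) \<tau> a h w g + jordan_polar (\<odot>) \<tau> a h w g) = 0"
    using b assms(2) 1 polar_a form.polar_perm(1)[of h a]
    by (simp add: form.polar_add form_polar_scale algebra_simps)
  then show ?thesis unfolding 2 using half by (simp add: distrib_right[symmetric])
qed

text \<open>For an axis without half component, multiplication by \<open>y\<close> therefore
  preserves the radical of \<open>H y\<close> on \<open>Eh\<close>.\<close>

lemma axis_relation_no_half:
  assumes b: "jordan_polar (\<odot>) \<tau> b b h g = 0"
    and "b = l *s a + y" "y \<in> E0" "y \<odot> y = y" "h \<in> Eh" "g \<in> Eh" "H y h g = 0"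
  shows "H y (y \<odot> h) g = 0"
proof -
  have yy: "y \<odot> h = y \<odot> (y \<odot> h) + y \<odot> (y \<odot> h)"
    using E0_mult_act[OF assms(3,3,5)] assms(4) by simp
  have 1: "jordan_polar (\<odot>) \<tau> a y h g = \<kappa> * H y h g"
    using assms(3-) by (simp add: form_polar_a_hom H_def comm form_comm algebra_simps)
  have "jordan_polar (\<odot>) \<tau> y y h g = 0"
    using b assms(2) 1 polar_a form.polar_perm(1)[of y a] assms(7)
    by (simp add: form.polar_add form_polar_scale algebra_simps)
  then have 2: "\<tau> (y \<odot> g) h + \<tau> (y \<odot> h \<odot> g) y + \<tau> (y \<odot> h \<odot> g) y
      - \<tau> (h \<odot> g) y - \<tau> (y \<odot> h) (y \<odot> g) - \<tau> (y \<odot> h) (y \<odot> g) = 0"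
    by (simp add: jordan_polar_def assms(4) comm form_comm algebra_simps)
  have 3: "\<tau> (y \<odot> h) g = \<tau> (y \<odot> (y \<odot> h)) g + \<tau> (y \<odot> (y \<odot> h)) g"
    by (metis yy form_add)
  have "H y (y \<odot> h) g + H y (y \<odot> h) g = 0"
    using 2 3 assms(7) form_comm[of h "y \<odot> g"] unfolding H_def by algebra
  then show ?thesis
    using two_neq by (simp add: mult_2[symmetric])
qed

text \<open>The defect is linear in \<open>z\<close>, so \<open>z\<close> may be taken in one Peirce
  space. After decomposing \<open>x \<odot> x\<close>, \<open>form_split\<close> leaves only
  pairings inside \<open>Eh\<close> and inside \<open>E0\<close>, which the three hypotheses match
  up.\<close>

lemma defect_eq_0I:
  assumes E1_adj: "\<And>k h g. \<lbrakk>k \<in> E1; h \<in> Eh; g \<in> Eh\<rbrakk> \<Longrightarrow> \<tau> (k \<odot> h) g = \<tau> h (k \<odot> g)"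
    and H0: "\<And>y h g. \<lbrakk>y \<in> E0; h \<in> Eh; g \<in> Eh\<rbrakk> \<Longrightarrow> H y h g = 0"
    and E0_defect: "\<And>y z. \<lbrakk>y \<in> E0; z \<in> E0\<rbrakk> \<Longrightarrow> jordan_defect (\<odot>) \<tau> y z = 0"
  shows "jordan_defect (\<odot>) \<tau> x z = 0"
proof -
  obtain k h y where x: "x = k + h + y" and k: "k \<in> E1" and h: "h \<in> Eh" and y: "y \<in> E0"
    by (rule peirce_decomposition)
  define n where "n = h \<odot> h - a \<odot> (h \<odot> h)"
  define u1 uh u0 where "u1 = k \<odot> k + a \<odot> (h \<odot> h)"
    and "uh = (k \<odot> h + k \<odot> h) + (y \<odot> h + y \<odot> h)" and "u0 = y \<odot> y + n"
  have n: "n \<in> E0" using Eh_Eh(2)[OF h h] by (simp add: n_def)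
  have u1: "u1 \<in> E1" and uh: "uh \<in> Eh" and u0: "u0 \<in> E0"
    unfolding u1_def uh_def u0_def
    using k h y n Eh_Eh subspace_add subspace_E1 subspace_Eh subspace_E0 fusion
    by (meson)+
  have xx: "x \<odot> x = u1 + uh + u0"
    using k h y
    by (simp add: x u1_def uh_def u0_def n_def mult_bilinear fusion comm[of h k] comm[of h y]
        algebra_simps)
  have H0': "\<tau> (h \<odot> g) y = \<tau> (y \<odot> h) g + \<tau> h (y \<odot> g)"
    if "y \<in> E0" "h \<in> Eh" "g \<in> Eh" for y h g
    using H0[OF that] by (simp add: H_def algebra_simps)
  have hom1: "jordan_defect (\<odot>) \<tau> x z = 0" if z: "z \<in> E1" for z
  proof -
    have uz: "x \<odot> x \<odot> z = u1 \<odot> z + z \<odot> uh + 0"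
      unfolding xx using z u1 uh u0 by (simp add: mult_add fusion comm[of z uh])
    have xz: "x \<odot> z = k \<odot> z + z \<odot> h + 0"
      unfolding x using k h y z by (simp add: mult_add fusion comm[of z h])
    have "\<tau> (x \<odot> x \<odot> z) x = \<tau> (z \<odot> uh) h + \<tau> 0 y"
      unfolding uz by (subst x, rule form_split)
        (use k h y z u1 uh u0 fusion subspace_0[OF subspace_E0] in auto)
    moreover have "\<tau> (x \<odot> x) (x \<odot> z) = \<tau> uh (z \<odot> h) + \<tau> u0 0"
      unfolding xz xx by (rule form_split)
        (use k h y z u1 uh u0 fusion subspace_0[OF subspace_E0] in auto)
    ultimately show ?thesis
      unfolding jordan_defect_def using E1_adj[OF z uh h] by (simp add: form_zero)
  qed
  \<comment> \<open>The terms in \<open>y\<close> and \<open>z\<close> alone form the defect on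
    \<open>E0\<close>. \<open>E0_act_Eh_Eh\<close> and the vanishing of \<open>H\<close> turn all
    others into pairings inside \<open>Eh\<close>.\<close>
  have hom0: "jordan_defect (\<odot>) \<tau> x z = 0" if z: "z \<in> E0" for z
  proof -
    have uz: "x \<odot> x \<odot> z = 0 + z \<odot> uh + u0 \<odot> z"
      unfolding xx using z u1 uh u0 by (simp add: mult_add fusion comm[of z uh])
    have xz: "x \<odot> z = 0 + z \<odot> h + y \<odot> z"
      unfolding x using k h y z by (simp add: mult_add fusion comm[of z h])
    have "\<tau> (x \<odot> x \<odot> z) x = \<tau> (z \<odot> uh) h + \<tau> (u0 \<odot> z) y"
      unfolding uz by (subst x, rule form_split)
        (use k h y z u1 uh u0 fusion subspace_0[OF subspace_E1] in auto)
    moreover have "\<tau> (x \<odot> x) (x \<odot> z) = \<tau> uh (z \<odot> h) + \<tau> u0 (y \<odot> z)"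
      unfolding xz xx by (rule form_split)
        (use k h y z u1 uh u0 fusion subspace_0[OF subspace_E1] in auto)
    moreover have "\<tau> (z \<odot> uh) h = \<tau> (z \<odot> (k \<odot> h)) h + \<tau> (z \<odot> (k \<odot> h)) h
        + \<tau> (z \<odot> (y \<odot> h)) h + \<tau> (z \<odot> (y \<odot> h)) h"
      and "\<tau> uh (z \<odot> h) = \<tau> (k \<odot> h) (z \<odot> h) + \<tau> (k \<odot> h) (z \<odot> h)
        + \<tau> (y \<odot> h) (z \<odot> h) + \<tau> (y \<odot> h) (z \<odot> h)"
      by (simp_all add: uh_def mult_bilinear form_bilinear)
    moreover have "\<tau> (z \<odot> (k \<odot> h)) h = \<tau> (k \<odot> h) (z \<odot> h)"
      using E1_adj[OF k E0_Eh(1)[OF z h] h] E1_E0_act_commute[OF k z h] by (simp add: form_comm)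
    moreover have "\<tau> (u0 \<odot> z) y = \<tau> (y \<odot> y \<odot> z) y + \<tau> (n \<odot> z) y"
      by (simp add: u0_def mult_bilinear form_bilinear)
    moreover have "\<tau> (n \<odot> z) y = \<tau> (z \<odot> h \<odot> h) y + \<tau> (z \<odot> h \<odot> h) y"
    proof -
      have "n \<odot> z = z \<odot> (h \<odot> h)"
        using E1_E0(2)[OF Eh_Eh(1)[OF h h] z] by (simp add: n_def comm[of _ z] mult_diff)
      then show ?thesis
        using E0_act_Eh_Eh[OF z h h] form_E1[OF Eh_Eh(1)[OF E0_Eh(1)[OF z h] h]]
        by (simp add: form_bilinear)
    qed
    moreover have "\<tau> (z \<odot> h \<odot> h) y = \<tau> (y \<odot> (z \<odot> h)) h + \<tau> (z \<odot> h) (y \<odot> h)"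
      using H0'[OF y E0_Eh(1)[OF z h] h] .
    moreover have "\<tau> u0 (y \<odot> z) = \<tau> (y \<odot> y) (y \<odot> z) + \<tau> (h \<odot> h) (y \<odot> z)"
      using form_E1[OF Eh_Eh(1)[OF h h]] by (simp add: u0_def n_def form_bilinear)
    moreover have "\<tau> (h \<odot> h) (y \<odot> z) = \<tau> (y \<odot> z \<odot> h) h + \<tau> (y \<odot> z \<odot> h) h"
      using H0'[OF E0_E0[OF y z] h h] by (simp add: form_comm)
    moreover have "\<tau> (y \<odot> z \<odot> h) h = \<tau> (y \<odot> (z \<odot> h)) h + \<tau> (z \<odot> (y \<odot> h)) h"
      using E0_mult_act[OF y z h] by (simp add: form_bilinear)
    moreover have "\<tau> (y \<odot> y \<odot> z) y = \<tau> (y \<odot> y) (y \<odot> z)"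
      using E0_defect[OF y z] by (simp add: jordan_defect_def)
    moreover have "\<tau> (z \<odot> h) (y \<odot> h) = \<tau> (y \<odot> h) (z \<odot> h)" by (rule form_comm)
    ultimately show ?thesis unfolding jordan_defect_def by algebra
  qed
  have homh: "jordan_defect (\<odot>) \<tau> x g = 0" if g: "g \<in> Eh" for g
  proof -
    have hg: "a \<odot> (h \<odot> g) \<in> E1" "h \<odot> g - a \<odot> (h \<odot> g) \<in> E0" using Eh_Eh[OF h g] by auto
    have uhg: "a \<odot> (uh \<odot> g) \<in> E1" "uh \<odot> g - a \<odot> (uh \<odot> g) \<in> E0" using Eh_Eh[OF uh g] by auto
    have mh: "u1 \<odot> g + u0 \<odot> g \<in> Eh" "k \<odot> g + y \<odot> g \<in> Eh"
      using k y u1 u0 g fusion subspace_add[OF subspace_Eh] by auto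
    have ug: "x \<odot> x \<odot> g = a \<odot> (uh \<odot> g) + (u1 \<odot> g + u0 \<odot> g) + (uh \<odot> g - a \<odot> (uh \<odot> g))"
      unfolding xx by (simp add: mult_add)
    have xg: "x \<odot> g = a \<odot> (h \<odot> g) + (k \<odot> g + y \<odot> g) + (h \<odot> g - a \<odot> (h \<odot> g))"
      unfolding x by (simp add: mult_add)
    have "\<tau> (x \<odot> x \<odot> g) x = \<tau> (u1 \<odot> g + u0 \<odot> g) h + \<tau> (uh \<odot> g - a \<odot> (uh \<odot> g)) y"
      unfolding ug by (subst x, rule form_split) (use k h y uhg mh in auto)
    moreover have "\<tau> (uh \<odot> g - a \<odot> (uh \<odot> g)) y = \<tau> (uh \<odot> g) y"
      using form_E1[OF uhg(1)] by (simp add: form_bilinear)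
    moreover have "\<tau> (x \<odot> x) (x \<odot> g) = \<tau> uh (k \<odot> g + y \<odot> g) + \<tau> u0 (h \<odot> g - a \<odot> (h \<odot> g))"
      unfolding xg xx by (rule form_split) (use u1 u0 uh hg mh in auto)
    moreover have "\<tau> u0 (h \<odot> g - a \<odot> (h \<odot> g)) = \<tau> (h \<odot> g) (y \<odot> y) + \<tau> (h \<odot> g) n"
      using form_E1[OF hg(1)] by (simp add: form_bilinear u0_def form_comm)
    moreover have "\<tau> (u1 \<odot> g + u0 \<odot> g) h =
        \<tau> (k \<odot> k \<odot> g) h + \<tau> (a \<odot> (h \<odot> h) \<odot> g) h + \<tau> (y \<odot> y \<odot> g) h + \<tau> (n \<odot> g) h"
      by (simp add: u1_def u0_def mult_bilinear form_bilinear)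
    moreover have "\<tau> (uh \<odot> g) y = \<tau> (k \<odot> h \<odot> g) y + \<tau> (k \<odot> h \<odot> g) y
        + \<tau> (y \<odot> h \<odot> g) y + \<tau> (y \<odot> h \<odot> g) y"
      and "\<tau> uh (k \<odot> g + y \<odot> g) = \<tau> (k \<odot> h) (k \<odot> g) + \<tau> (k \<odot> h) (k \<odot> g)
        + \<tau> (y \<odot> h) (k \<odot> g) + \<tau> (y \<odot> h) (k \<odot> g) + \<tau> (k \<odot> h) (y \<odot> g) + \<tau> (k \<odot> h) (y \<odot> g)
        + \<tau> (y \<odot> h) (y \<odot> g) + \<tau> (y \<odot> h) (y \<odot> g)"
      by (simp_all add: uh_def mult_bilinear form_bilinear)
    \<comment> \<open>\<open>Eh_cube\<close> trades the action on \<open>h\<close> of the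
      \<open>E1\<close> component of \<open>h \<odot> h\<close> for that of \<open>n\<close>, which
      lies in \<open>E0\<close>, where the vanishing of \<open>H\<close> applies.\<close>
    moreover have "\<tau> (k \<odot> k \<odot> g) h = \<tau> (k \<odot> h) (k \<odot> g) + \<tau> (k \<odot> h) (k \<odot> g)"
      using E1_mult_act[OF k k g] E1_adj[OF k E1_Eh(1)[OF k g] h]
      by (simp add: form_bilinear form_comm[of "k \<odot> h"])
    moreover have "\<tau> (a \<odot> (h \<odot> h) \<odot> g) h = \<tau> (n \<odot> h) g"
    proof -
      have "n \<odot> h = a \<odot> (h \<odot> h) \<odot> h"
        using Eh_cube[OF h] by (simp add: n_def mult_diff)
      then show ?thesis
        using E1_adj[OF Eh_Eh(1)[OF h h] g h] by (simp add: form_comm)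
    qed
    moreover have "\<tau> (k \<odot> h \<odot> g) y = \<tau> (y \<odot> (k \<odot> h)) g + \<tau> (k \<odot> h) (y \<odot> g)"
      using H0'[OF y E1_Eh(1)[OF k h] g] .
    moreover have "\<tau> (y \<odot> h \<odot> g) y = \<tau> (y \<odot> (y \<odot> h)) g + \<tau> (y \<odot> h) (y \<odot> g)"
      using H0'[OF y E0_Eh(1)[OF y h] g] .
    moreover have "\<tau> (h \<odot> g) (y \<odot> y) = \<tau> (y \<odot> y \<odot> h) g + \<tau> (y \<odot> y \<odot> g) h"
      using H0'[OF E0_E0[OF y y] h g] by (simp add: form_comm[of h])
    moreover have "\<tau> (h \<odot> g) n = \<tau> (n \<odot> h) g + \<tau> (n \<odot> g) h"
      using H0'[OF n h g] by (simp add: form_comm[of h])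
    moreover have "\<tau> (y \<odot> y \<odot> h) g = \<tau> (y \<odot> (y \<odot> h)) g + \<tau> (y \<odot> (y \<odot> h)) g"
      using E0_mult_act[OF y y h] by (simp add: form_bilinear)
    moreover have "\<tau> (y \<odot> h) (k \<odot> g) = \<tau> (y \<odot> (k \<odot> h)) g"
      using E1_adj[OF k E0_Eh(1)[OF y h] g] E1_E0_act_commute[OF k y h] by simp
    ultimately show ?thesis unfolding jordan_defect_def by algebra
  qed
  obtain k' h' y' where z: "z = k' + h' + y'" "k' \<in> E1" "h' \<in> Eh" "y' \<in> E0"
    by (rule peirce_decomposition)
  have "jordan_defect (\<odot>) \<tau> x z =
      jordan_defect (\<odot>) \<tau> x k' + jordan_defect (\<odot>) \<tau> x h' + jordan_defect (\<odot>) \<tau> x y'"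
    by (simp add: z(1) jordan_defect_def mult_bilinear form_bilinear)
  then show ?thesis using hom1 hom0 homh z by simp
qed

end

section \<open>Forms compatible with a generating set of axes in dimension at most four\<close>

locale peirce_cocycle =
  fin_dim_peirce_jordan_algebra scale mult a \<kappa> Basis + peirce_form scale mult a \<kappa> \<tau>
  for scale :: "'f::field \<Rightarrow> 'b::ab_group_add \<Rightarrow> 'b" (infixr \<open>*s\<close> 75)
    and mult :: "'b \<Rightarrow> 'b \<Rightarrow> 'b" (infixl \<open>\<odot>\<close> 70) and a \<kappa> Basis \<tau> +
  fixes X :: "'b set"
  assumes X_idem: "b \<in> X \<Longrightarrow> b \<odot> b = b"
    and X_polar1: "b \<in> X \<Longrightarrow> jordan_polar (\<odot>) \<tau> b b w y = 0"
    and X_polar2: "b \<in> X \<Longrightarrow> jordan_polar (\<odot>) \<tau> b z w b = 0"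
    and X_gen: "generates X"
    and dim_le_4: "dim (UNIV :: 'b set) \<le> 4"
    and Eh_nontrivial: "\<exists>h\<in>Eh. h \<noteq> 0"
begin

section \<open>Peirce components of the generators\<close>

lemma a_nonzero: "a \<noteq> 0"
  using Eh_nontrivial half_neq by (auto simp: Eh_def)

lemma dim_pos: "x \<in> S \<Longrightarrow> x \<noteq> 0 \<Longrightarrow> 1 \<le> dim S"
  using dim_eq_0[of S] by (cases "dim S") auto

lemma dim_E1_pos: "1 \<le> dim E1"
  using dim_pos[of a E1] a_E1 a_nonzero by simp

lemma dim_Eh_pos: "1 \<le> dim Eh"
  using dim_pos[of _ Eh] Eh_nontrivial by auto

lemma peirce_unique:
  assumes "k + h + y = k' + h' + y'" "k \<in> E1" "k' \<in> E1" "h \<in> Eh" "h' \<in> Eh" "y \<in> E0" "y' \<in> E0"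
  shows "k = k'" "h = h'" "y = y'"
proof -
  have "(k - k') + (h - h') = y' - y"
    using assms(1) by (simp add: algebra_simps)
  then have "(k - k') + (h - h') \<in> E0"
    using assms subspace_diff[OF subspace_E0] by simp
  moreover have "k - k' \<in> E1" "h - h' \<in> Eh"
    using assms subspace_diff[OF subspace_E1] subspace_diff[OF subspace_Eh] by auto
  ultimately have "k - k' = 0" "h - h' = 0"
    using E1_plus_Eh_Int_E0 by blast+
  then show "k = k'" "h = h'" by simp_all
  then show "y = y'" using assms(1) by simp
qed

lemma X_components:
  assumes "b \<in> X"
  obtains k h y where "b = k + h + y" "k \<in> E1" "h \<in> Eh" "y \<in> E0"
    "k \<odot> k + a \<odot> (h \<odot> h) = k" "(k \<odot> h + k \<odot> h) + (y \<odot> h + y \<odot> h) = h"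
    "y \<odot> y + (h \<odot> h - a \<odot> (h \<odot> h)) = y"
proof -
  obtain k h y where b: "b = k + h + y" and k: "k \<in> E1" and h: "h \<in> Eh" and y: "y \<in> E0"
    by (rule peirce_decomposition)
  have "(k \<odot> k + a \<odot> (h \<odot> h)) + ((k \<odot> h + k \<odot> h) + (y \<odot> h + y \<odot> h))
      + (y \<odot> y + (h \<odot> h - a \<odot> (h \<odot> h))) = k + h + y"
    using X_idem[OF assms] k h y
    by (simp add: b mult_add fusion comm[of h k] comm[of h y] algebra_simps)
  from peirce_unique[OF this] show ?thesis
    using that[OF b k h y] k h y fusion Eh_Eh[OF h h] subspace_add[OF subspace_E1]
      subspace_add[OF subspace_Eh] subspace_add[OF subspace_E0] by simp
qed

lemma span_scale_base: "x \<in> S \<Longrightarrow> c *s x \<in> span S"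
  by (intro span_scale span_base)

lemma scaled_act: "h \<in> Eh \<Longrightarrow> l *s a \<odot> h + l *s a \<odot> h = l *s h"
  by (simp only: mult_scale act scale_right_distrib[of l, symmetric] half_scale)

text \<open>The elements without half component form the subalgebra \<open>E1 + E0\<close>, the
  kernel of \<open>L_a^2 - L_a\<close>. If it contained \<open>X\<close> it would be everything,
  against \<open>Eh\<close> being non-zero.\<close>

lemma ex_axis_half:
  obtains b k h y where "b \<in> X" "b = k + h + y" "k \<in> E1" "h \<in> Eh" "y \<in> E0" "h \<noteq> 0"
    "k \<odot> k + a \<odot> (h \<odot> h) = k" "(k \<odot> h + k \<odot> h) + (y \<odot> h + y \<odot> h) = h"
    "y \<odot> y + (h \<odot> h - a \<odot> (h \<odot> h)) = y"
proof (cases "\<forall>b\<in>X. a \<odot> (a \<odot> b) = a \<odot> b")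
  case True
  let ?M = "{x. a \<odot> (a \<odot> x) = a \<odot> x}"
  have split: "x = a \<odot> x + (x - a \<odot> x)" "a \<odot> x \<in> E1" "x - a \<odot> x \<in> E0" if "x \<in> ?M" for x
    using that by (simp_all add: E1_def E0_def mult_diff)
  have "subspace ?M" by (auto simp: subspace_def mult_bilinear)
  moreover have "x \<odot> y \<in> ?M" if x: "x \<in> ?M" and y: "y \<in> ?M" for x y
  proof -
    have "x \<odot> y = (a \<odot> x + (x - a \<odot> x)) \<odot> (a \<odot> y + (y - a \<odot> y))" by simp
    also have "\<dots> = a \<odot> x \<odot> (a \<odot> y) + (x - a \<odot> x) \<odot> (y - a \<odot> y)"
      unfolding mult_add E1_E0(1)[OF split(2)[OF x] split(3)[OF y]]
        E1_E0(2)[OF split(2)[OF y] split(3)[OF x]] by simp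
    finally show ?thesis
      using split[OF x] split[OF y] fusion(1,2) by (simp add: mult_add act)
  qed
  ultimately have "subalgebra ?M" by (simp add: subalgebra_def)
  then have "subalgebra hull X \<subseteq> ?M"
    by (intro hull_minimal) (use True in auto)
  moreover obtain h where h: "h \<in> Eh" "h \<noteq> 0" using Eh_nontrivial by blast
  ultimately have "a \<odot> (a \<odot> h) = a \<odot> h" using X_gen by (auto simp: generates_def)
  then show ?thesis using h half_neq by (simp add: act mult_scale)
next
  case False
  then obtain b where b: "b \<in> X" "a \<odot> (a \<odot> b) \<noteq> a \<odot> b" by blast
  obtain k h y where c: "b = k + h + y" "k \<in> E1" "h \<in> Eh" "y \<in> E0"
    "k \<odot> k + a \<odot> (h \<odot> h) = k" "(k \<odot> h + k \<odot> h) + (y \<odot> h + y \<odot> h) = h"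
    "y \<odot> y + (h \<odot> h - a \<odot> (h \<odot> h)) = y"
    by (rule X_components[OF b(1)])
  have "h \<noteq> 0" using b(2) c(1-4) by (auto simp: mult_add act)
  then show ?thesis using that b(1) c by blast
qed

lemma axis_half: "\<lbrakk>b \<in> X; b = k + h + y; k \<in> E1; h \<in> Eh; y \<in> E0; g \<in> Eh\<rbrakk>
    \<Longrightarrow> \<tau> (k \<odot> h) g - \<tau> (k \<odot> g) h + H y h g = 0"
  using axis_relation_half[OF X_polar2] by blast

lemma Eh_span_1:
  assumes "dim Eh \<le> 1" obtains h where "h \<in> Eh" "\<And>g. g \<in> Eh \<Longrightarrow> \<exists>c. g = c *s h"
  using dim_le_1_ex[OF subspace_Eh assms] by blast

lemma ex_not_multiple:
  assumes "2 \<le> dim S" obtains y where "y \<in> S" "\<And>c. y \<noteq> c *s x"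
  using dim_le_1I[of S x] assms by force

text \<open>If \<open>E1\<close> or \<open>Eh\<close> is a line, \<open>k\<close> acts on
  \<open>Eh\<close> as a scalar. Otherwise the dimensions are (2, 2, 0), and one self-adjoint
  \<open>k0\<close> in \<open>E1\<close> off the line of \<open>a\<close> suffices.\<close>

lemma E1_adjoint:
  assumes k: "k \<in> E1" and h: "h \<in> Eh" and g: "g \<in> Eh"
  shows "\<tau> (k \<odot> h) g = \<tau> h (k \<odot> g)"
proof -
  consider "dim E1 \<le> 1" | "dim Eh \<le> 1" | "2 \<le> dim E1" "2 \<le> dim Eh" by linarith
  then show ?thesis
  proof cases
    case 1
    obtain c where "k = c *s a"
      by (rule dim_le_1[OF subspace_E1 1 a_E1 a_nonzero k])
    then show ?thesis using h g by (simp add: mult_scale form_bilinear act)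
  next
    case 2
    obtain e where e: "e \<in> Eh" "\<And>g. g \<in> Eh \<Longrightarrow> \<exists>c. g = c *s e" by (rule Eh_span_1[OF 2]) blast
    obtain c d r where "h = c *s e" "g = d *s e" "k \<odot> e = r *s e"
      using e h g E1_Eh(1)[OF k e(1)] by meson
    then show ?thesis by (simp add: mult_scale form_bilinear)
  next
    case 3
    then have dims: "dim E1 \<le> 2" "dim Eh \<le> 2" "dim E0 = 0" "dim (UNIV :: 'b set) = 4"
      using dim_peirce dim_le_4 by linarith+
    then have E0: "y = 0" if "y \<in> E0" for y
      using that dim_eq_0[of E0] by auto
    have aEh: "a \<odot> (u \<odot> v) = u \<odot> v" if "u \<in> Eh" "v \<in> Eh" for u v
      using E0[OF Eh_Eh(2)[OF that]] by simp
    have reduce: ?thesis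
      if k0: "k0 \<in> E1" "\<And>c. k0 \<noteq> c *s a"
        and adj: "\<And>h g. h \<in> Eh \<Longrightarrow> g \<in> Eh \<Longrightarrow> \<tau> (k0 \<odot> h) g = \<tau> h (k0 \<odot> g)" for k0
    proof -
      obtain c d where "k = c *s a + d *s k0"
        by (rule dim_le_2[OF subspace_E1 dims(1) a_E1 a_nonzero k0 k]) blast
      then show ?thesis using h g adj[OF h g] by (simp add: mult_bilinear form_bilinear act)
    qed
    show ?thesis
    proof (cases "\<exists>b\<in>X. \<exists>k0 h0. b = k0 + h0 \<and> k0 \<in> E1 \<and> h0 \<in> Eh \<and> (\<forall>c. k0 \<noteq> c *s a)")
      case True
      then obtain b k0 h0 where b: "b \<in> X" "b = k0 + h0" "k0 \<in> E1" "h0 \<in> Eh" "\<And>c. k0 \<noteq> c *s a"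
        by blast
      show ?thesis
      proof (rule reduce[OF b(3,5)])
        fix h g assume h: "h \<in> Eh" and g: "g \<in> Eh"
        show "\<tau> (k0 \<odot> h) g = \<tau> h (k0 \<odot> g)"
        \<comment> \<open>If \<open>h0 = 0\<close>, then \<open>k0\<close> is a generator, and its
          relation equates \<open>\<tau> (k0 \<odot> g) h\<close> with an expression symmetric in
          \<open>h\<close> and \<open>g\<close>. Otherwise \<open>axis_half\<close> gives the
          symmetry on a basis \<open>h0\<close>, \<open>h1\<close> of \<open>Eh\<close>.\<close>
        proof (cases "h0 = 0")
          case True
          then have b: "k0 \<in> X" using b by simp
          have "\<tau> (k0 \<odot> g) h = \<tau> (k0 \<odot> h) (k0 \<odot> g) + \<tau> (k0 \<odot> h) (k0 \<odot> g)" if "h \<in> Eh" "g \<in> Eh" for h g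
            using X_polar1[OF b, of h g] X_idem[OF b] form_E1[OF \<open>k0 \<in> E1\<close>] that
            by (simp add: jordan_polar_def comm form_comm algebra_simps)
          from this[OF h g] this[OF g h] show ?thesis by (simp add: form_comm)
        next
          case False
          obtain h1 where h1: "h1 \<in> Eh" "\<And>c. h1 \<noteq> c *s h0" by (rule ex_not_multiple[OF 3(2)]) blast
          have rel: "\<tau> (k0 \<odot> h0) h1 = \<tau> (k0 \<odot> h1) h0"
            using axis_half[OF b(1) _ b(3,4) subspace_0[OF subspace_E0] h1(1)] b(2)
            by (simp add: H_bilinear)
          obtain c d where "h = c *s h0 + d *s h1"
            by (rule dim_le_2[OF subspace_Eh dims(2) b(4) False h1 h]) blast
          moreover obtain c' d' where "g = c' *s h0 + d' *s h1"
            by (rule dim_le_2[OF subspace_Eh dims(2) b(4) False h1 g]) blast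
          ultimately show ?thesis
            using rel form_comm[of h0 "k0 \<odot> h1"] form_comm[of h1 "k0 \<odot> h0"]
              form_comm[of h0 "k0 \<odot> h0"] form_comm[of h1 "k0 \<odot> h1"]
            by (simp add: mult_bilinear form_bilinear algebra_simps)
        qed
      qed
    next
      case False
      \<comment> \<open>Now every \<open>E1\<close> component is a multiple \<open>l *s a\<close>. A
        non-zero half component forces \<open>l = 1\<close>, and then the \<open>E1\<close> part of
        \<open>b \<odot> b = b\<close> gives \<open>h \<odot> h = 0\<close>.\<close>
      have X: "\<exists>l h. b = l *s a + h \<and> h \<in> Eh \<and> (h \<noteq> 0 \<longrightarrow> h \<odot> h = 0)" if b: "b \<in> X" for b
      proof -
        obtain k h y where c: "b = k + h + y" "k \<in> E1" "h \<in> Eh" "y \<in> E0"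
          "k \<odot> k + a \<odot> (h \<odot> h) = k" "(k \<odot> h + k \<odot> h) + (y \<odot> h + y \<odot> h) = h"
          using X_components[OF b] by metis
        have y: "y = 0" using E0 c by simp
        obtain l where l: "k = l *s a" using False b c(1-3) y by (metis add.right_neutral)
        have "h \<odot> h = 0" if "h \<noteq> 0"
        proof -
          have "l *s h = h" using c(6) scaled_act[OF c(3), of l] by (simp add: y l)
          then have "l = 1" using that by (metis scale_cancel_right scale_one)
          then show ?thesis using c(5) l aEh[OF c(3,3)] idem by simp
        qed
        then show ?thesis using c(1,3) y l by auto
      qed
      obtain b1 k1 h1 y1 where "b1 \<in> X" "b1 = k1 + h1 + y1" "k1 \<in> E1" "h1 \<in> Eh" "y1 \<in> E0" "h1 \<noteq> 0"
        by (rule ex_axis_half)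
      moreover obtain l h1' where "b1 = l *s a + h1'" "h1' \<in> Eh" "h1' \<noteq> 0 \<longrightarrow> h1' \<odot> h1' = 0"
        using X[OF \<open>b1 \<in> X\<close>] by blast
      moreover have "h1 = h1'"
        using calculation peirce_unique(2)[of k1 h1 y1 "l *s a" h1' 0] E0
          subspace_scale[OF subspace_E1 a_E1] subspace_0[OF subspace_E0] by auto
      ultimately have h1: "h1 \<in> Eh" "h1 \<noteq> 0" "h1 \<odot> h1 = 0" by auto
      have "\<exists>b\<in>X. \<exists>l h. b = l *s a + h \<and> h \<in> Eh \<and> (h \<noteq> 0 \<longrightarrow> h \<odot> h = 0) \<and> (\<forall>c. h \<noteq> c *s h1)"
      proof (rule ccontr)
        assume not: "\<not> ?thesis"
        have "X \<subseteq> span {a, h1}"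
        proof
          fix b assume b: "b \<in> X"
          then obtain l h where "b = l *s a + h" "h \<in> Eh" "h \<noteq> 0 \<longrightarrow> h \<odot> h = 0" using X by blast
          moreover then obtain c where "h = c *s h1" using not b by blast
          ultimately show "b \<in> span {a, h1}" by (simp add: span_add span_scale span_base)
        qed
        then have "dim (UNIV :: 'b set) \<le> card {a, h1}"
          by (rule generates_dim_le[OF X_gen])
            (use h1 in \<open>auto simp: idem act span_zero span_base span_scale_base\<close>)
        then show False using dims(4) card_insert_le_m1[of 2 "{h1}" a] by simp
      qed
      then obtain h2 where h2: "h2 \<in> Eh" "h2 \<odot> h2 = 0" "\<And>c. h2 \<noteq> c *s h1"
        by (metis scale_zero_left)
      \<comment> \<open>The product of two independent half components acts as zero on
        \<open>Eh\<close>, hence is self-adjoint. Since \<open>E0 = 0\<close>,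
        \<open>Eh_cube\<close> makes every cube in \<open>Eh\<close> vanish; comparing
        \<open>h1 + h2\<close> with \<open>h1 - h2\<close> needs division by 2 only.\<close>
      define k0 where "k0 = h1 \<odot> h2"
      have k0: "k0 \<in> E1" using Eh_Eh(1)[OF h1(1) h2(1)] aEh[OF h1(1) h2(1)] by (simp add: k0_def)
      have cube: "u \<odot> u \<odot> u = 0" if "u \<in> Eh" for u
        using Eh_cube[OF that] aEh[OF that that] by simp
      have "(h1 + h2) \<odot> (h1 + h2) = k0 + k0" "(h1 - h2) \<odot> (h1 - h2) = - (k0 + k0)"
        by (simp_all add: mult_bilinear k0_def h1 h2 comm[of h2 h1])
      then have "(k0 + k0) \<odot> (h1 + h2) = 0" "- (k0 + k0) \<odot> (h1 - h2) = 0"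
        using cube[of "h1 + h2"] cube[of "h1 - h2"] h1 h2 subspace_add[OF subspace_Eh]
          subspace_diff[OF subspace_Eh] by metis+
      then have "(k0 + k0) \<odot> (h1 + h2) = 0" "(k0 + k0) \<odot> (h1 - h2) = 0"
        by (simp_all only: mult_minus neg_equal_0_iff_equal)
      then have 1: "k0 \<odot> (h1 + h2) = 0" "k0 \<odot> (h1 - h2) = 0"
        using double_eq_0 mult_add(1) by metis+
      then have "k0 \<odot> h1 + k0 \<odot> h1 = 0" by (simp add: mult_bilinear)
      then have kh1: "k0 \<odot> h1 = 0" by (rule double_eq_0)
      then have kh2: "k0 \<odot> h2 = 0" using 1 by (simp add: mult_add)
      have kEh: "k0 \<odot> u = 0" if u: "u \<in> Eh" for u
      proof -
        obtain c d where "u = c *s h1 + d *s h2"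
          by (rule dim_le_2[OF subspace_Eh dims(2) h1(1,2) h2(1,3) u]) blast
        then show ?thesis by (simp add: mult_bilinear kh1 kh2)
      qed
      \<comment> \<open>Otherwise \<open>a\<close>, \<open>h1\<close>, \<open>h2\<close> would span
        a subalgebra containing \<open>X\<close>.\<close>
      have "k0 \<noteq> c *s a" for c
      proof
        assume c: "k0 = c *s a"
        have "X \<subseteq> span {a, h1, h2}"
        proof
          fix b assume b: "b \<in> X"
          then obtain l h where "b = l *s a + h" "h \<in> Eh" using X by blast
          moreover then obtain c d where "h = c *s h1 + d *s h2"
            using dim_le_2[OF subspace_Eh dims(2) h1(1,2) h2(1,3), of h] by metis
          ultimately show "b \<in> span {a, h1, h2}" by (simp add: span_add span_scale span_base)
        qed
        then have "dim (UNIV :: 'b set) \<le> card {a, h1, h2}"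
          by (rule generates_dim_le[OF X_gen])
            (use h1 h2 in \<open>auto simp: idem act comm[of h2 h1] k0_def[symmetric] c
              span_zero span_base span_scale_base\<close>)
        then show False using dims(4) card_insert_le_m1[of 3 "{h1, h2}" a]
            card_insert_le_m1[of 2 "{h2}" h1] by simp
      qed
      from reduce[OF k0 this] show ?thesis by (simp add: kEh form_bilinear)
    qed
  qed
qed

lemma card_le:
  "card {x, y, z} \<le> 3" "card {x, y} \<le> 2"
  by (simp_all add: card_insert_if)

text \<open>If \<open>Eh\<close> is a line, it is spanned by the half component of a generator and
  the diagonal relation suffices. Otherwise, for \<open>y\<close> non-zero, the dimensions are (1,
  2, 1).\<close>

lemma H_eq_0:
  assumes y: "y \<in> E0" and h: "h \<in> Eh" and g: "g \<in> Eh"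
  shows "H y h g = 0"
proof (cases "dim Eh \<le> 1 \<or> y = 0")
  case True
  then show ?thesis
  proof
    assume 1: "dim Eh \<le> 1"
    obtain b k0 h0 y0 where b: "b \<in> X" "b = k0 + h0 + y0" "k0 \<in> E1" "h0 \<in> Eh" "y0 \<in> E0" "h0 \<noteq> 0"
      by (rule ex_axis_half)
    obtain c where "h = c *s h0" by (rule dim_le_1[OF subspace_Eh 1 b(4,6) h])
    moreover obtain d where "g = d *s h0" by (rule dim_le_1[OF subspace_Eh 1 b(4,6) g])
    moreover have "H y h0 h0 = 0"
      using axis_relation_zero[OF X_polar2[OF b(1)] b(2-5) y] .
    ultimately show ?thesis by (simp add: H_bilinear)
  qed (simp add: H_bilinear)
next
  case False
  then have "1 \<le> dim E0" using dim_pos[of y E0] y by simp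
  then have dims: "dim E1 \<le> 1" "dim E0 \<le> 1" "dim Eh \<le> 2" "dim (UNIV :: 'b set) = 4"
    using False dim_peirce dim_le_4 dim_E1_pos by linarith+
  have y0: "y \<noteq> 0" using False by simp
  have E1: "\<exists>l. k = l *s a" if k: "k \<in> E1" for k
    by (rule dim_le_1[OF subspace_E1 dims(1) a_E1 a_nonzero k]) blast
  have E0: "\<exists>l. z = l *s y" if z: "z \<in> E0" for z
    by (rule dim_le_1[OF subspace_E0 dims(2) y y0 z]) blast
  txt \<open>The radical of \<open>H y\<close> contains the half components of all generators. If it were at most a
    line, the algebra generated by \<open>X\<close> would lie in its span with \<open>a\<close> and \<open>y\<close>, a proper subspace.\<close>
  define R where "R = {h \<in> Eh. \<forall>g\<in>Eh. H y h g = 0}"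
  have subR: "subspace R"
    using subspace_Eh by (auto simp: R_def subspace_def H_bilinear)
  \<comment> \<open>If \<open>n\<close> is non-zero, \<open>axis_half\<close> puts \<open>h\<close>
    into \<open>R\<close>, as \<open>l *s a\<close> acts by a scalar. If \<open>n = 0\<close> and
    \<open>h\<close> is non-zero, then \<open>l = 1\<close> and \<open>axis_relation_a_half\<close>
    applies.\<close>
  have X: "\<exists>l h n. b = l *s a + h + n *s y \<and> h \<in> R \<and> (l *s h + n *s (y \<odot> h + y \<odot> h) = h)
      \<and> (n = 0 \<longrightarrow> h \<noteq> 0 \<longrightarrow> h \<odot> h = 0) \<and> (h = 0 \<longrightarrow> n *s y \<odot> n *s y = n *s y)"
    if b: "b \<in> X" for b
  proof -
    obtain k h z where c: "b = k + h + z" "k \<in> E1" "h \<in> Eh" "z \<in> E0"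
      "k \<odot> k + a \<odot> (h \<odot> h) = k" "(k \<odot> h + k \<odot> h) + (z \<odot> h + z \<odot> h) = h"
      "z \<odot> z + (h \<odot> h - a \<odot> (h \<odot> h)) = z"
      using X_components[OF b] by metis
    obtain l where l: "k = l *s a" using E1 c by blast
    obtain n where n: "z = n *s y" using E0 c by blast
    have half: "l *s h + n *s (y \<odot> h + y \<odot> h) = h"
      using c(6) scaled_act[OF c(3), of l] by (simp add: l n mult_scale scale_right_distrib)
    have l1: "l = 1" if "n = 0" "h \<noteq> 0"
      using half that by (metis add.right_neutral scale_cancel_right scale_one scale_zero_left)
    have "h \<odot> h = 0" if "n = 0" "h \<noteq> 0"
      using c(5,7) l1[OF that] that by (simp add: l n idem)
    moreover have "H y h g = 0" if g: "g \<in> Eh" for g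
    proof (cases "n = 0 \<and> h \<noteq> 0")
      case True
      then show ?thesis
        using axis_relation_a_half[OF X_polar1[OF b] _ c(3) y g, of l] c(1) l1 n by (simp add: l)
    next
      case False
      have "n * H y h g = 0"
        using axis_half[OF b c(1-4) g] c(3) g
        by (simp add: l n H_bilinear mult_scale form_bilinear act form_comm[of g])
      then show ?thesis using False by (auto simp: H_bilinear)
    qed
    ultimately show ?thesis
      using c(1,3,7) half by (intro exI[of _ l] exI[of _ h] exI[of _ n]) (auto simp: R_def l n)
  qed
  have "R = Eh"
  proof (rule ccontr)
    assume "R \<noteq> Eh"
    moreover have "R \<subseteq> Eh" by (auto simp: R_def)
    ultimately have "dim R \<le> 1"
      using subspace_dim_equal[OF subR subspace_Eh] dims(3) False by force
    from dim_le_1_ex[OF subR this]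
    obtain r where r: "r \<in> R" and Rr: "\<And>h. h \<in> R \<Longrightarrow> \<exists>c. h = c *s r" by blast
    have rEh: "r \<in> Eh" using r by (simp add: R_def)
    obtain c1 where c1: "a \<odot> (r \<odot> r) = c1 *s a" using E1 Eh_Eh[OF rEh rEh] by blast
    obtain c2 where "r \<odot> r - a \<odot> (r \<odot> r) = c2 *s y" using E0 Eh_Eh[OF rEh rEh] by blast
    then have rr: "r \<odot> r = c1 *s a + c2 *s y" by (simp add: c1 algebra_simps)
    obtain e where yy: "y \<odot> y = e *s y" using E0 E0_E0[OF y y] by blast
    \<comment> \<open>If \<open>r\<close> were an eigenvector of \<open>y\<close>, then
      \<open>a\<close>, \<open>r\<close>, \<open>y\<close> would span a subalgebra containing
      \<open>X\<close>.\<close>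
    have yr: "y \<odot> r \<noteq> c *s r" for c
    proof
      assume c: "y \<odot> r = c *s r"
      have "X \<subseteq> span {a, r, y}"
      proof
        fix b assume "b \<in> X"
        then obtain l h n where "b = l *s a + h + n *s y" "h \<in> R" using X by blast
        moreover then obtain d where "h = d *s r" using Rr by blast
        ultimately show "b \<in> span {a, r, y}" by (simp add: span_add span_scale_base)
      qed
      then have "dim (UNIV :: 'b set) \<le> card {a, r, y}"
        by (rule generates_dim_le[OF X_gen])
          (use rEh y in \<open>auto simp: idem act rr yy c comm[of r y]
              span_zero span_base span_scale_base span_add\<close>)
      then show False using dims(4) card_le(1)[of a r y] by simp
    qed
    \<comment> \<open>A non-zero \<open>E0\<close> component makes \<open>r\<close> an eigenvector
      of \<open>y\<close>: through the half part of \<open>b \<odot> b = b\<close> if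
      \<open>h\<close> is non-zero, and otherwise because \<open>axis_relation_no_half\<close> puts
      \<open>y \<odot> r\<close> into the line \<open>R\<close>.\<close>
    have X': "\<exists>l h. b = l *s a + h \<and> h \<in> R \<and> (h \<noteq> 0 \<longrightarrow> h \<odot> h = 0)" if b: "b \<in> X" for b
    proof -
      obtain l h n where c: "b = l *s a + h + n *s y" "h \<in> R"
        "l *s h + n *s (y \<odot> h + y \<odot> h) = h" "n = 0 \<longrightarrow> h \<noteq> 0 \<longrightarrow> h \<odot> h = 0"
        "h = 0 \<longrightarrow> n *s y \<odot> n *s y = n *s y"
        using X[OF b] by blast
      have "n = 0"
      proof (rule ccontr)
        assume n: "n \<noteq> 0"
        have h0: "h = 0"
        proof (rule ccontr)
          assume "h \<noteq> 0"
          obtain d where d: "h = d *s r" using Rr c(2) by blast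
          then have d0: "d \<noteq> 0" using \<open>h \<noteq> 0\<close> by auto
          have "(n * d) *s (y \<odot> r + y \<odot> r) = (d - l * d) *s r"
            using c(3) by (simp add: d mult_scale algebra_simps)
          then have "y \<odot> r + y \<odot> r = (inverse (n * d) * (d - l * d)) *s r"
            using n d0 by (metis scale_scale left_inverse mult_eq_0_iff scale_one)
          then have "\<kappa> *s (y \<odot> r + y \<odot> r) = (\<kappa> * (inverse (n * d) * (d - l * d))) *s r"
            by simp
          then have "y \<odot> r = (\<kappa> * (inverse (n * d) * (d - l * d))) *s r"
            by (simp only: scale_right_distrib half_scale)
          then show False using yr by blast
        qed
        have "H (n *s y) ((n *s y) \<odot> r) g = 0" if g: "g \<in> Eh" for g
        proof (rule axis_relation_no_half[OF X_polar1[OF b]])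
          show "b = l *s a + n *s y" "n *s y \<odot> n *s y = n *s y" using c h0 by auto
          show "n *s y \<in> E0" using y subspace_scale[OF subspace_E0] by blast
          show "H (n *s y) r g = 0" using r g by (simp add: R_def H_bilinear)
        qed (fact rEh g)+
        then have "y \<odot> r \<in> R"
          using n E0_Eh(1)[OF y rEh] by (simp add: R_def mult_scale H_bilinear)
        then show False using Rr yr by blast
      qed
      then show ?thesis using c(1,2,4) by auto
    qed
    \<comment> \<open>Some generator has a non-zero half component, a multiple of \<open>r\<close>.
      So \<open>r \<odot> r = 0\<close>, and already \<open>a\<close> and \<open>r\<close> span a
      subalgebra containing \<open>X\<close>.\<close>
    obtain b k1 h1 y1 where b: "b \<in> X" "b = k1 + h1 + y1" "k1 \<in> E1" "h1 \<in> Eh" "y1 \<in> E0" "h1 \<noteq> 0"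
      by (rule ex_axis_half)
    obtain l h where c: "b = l *s a + h" "h \<in> R" "h \<noteq> 0 \<longrightarrow> h \<odot> h = 0"
      using X'[OF b(1)] by blast
    have "h1 = h"
      using peirce_unique(2)[of k1 h1 y1 "l *s a" h 0] b c subspace_scale[OF subspace_E1 a_E1]
        subspace_0[OF subspace_E0] by (auto simp: R_def)
    moreover obtain d where "h = d *s r" using Rr c(2) by blast
    ultimately have rr: "r \<odot> r = 0" using c(3) b(6) by (auto simp: mult_scale)
    have "X \<subseteq> span {a, r}"
    proof
      fix b assume "b \<in> X"
      then obtain l h where "b = l *s a + h" "h \<in> R" using X' by blast
      moreover then obtain d where "h = d *s r" using Rr by blast
      ultimately show "b \<in> span {a, r}" by (simp add: span_add span_scale_base)
    qed
    then have "dim (UNIV :: 'b set) \<le> card {a, r}"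
      by (rule generates_dim_le[OF X_gen])
        (use rEh in \<open>auto simp: idem act rr span_zero span_base span_scale_base\<close>)
    then show False using dims(4) card_le(2)[of a r] by simp
  qed
  then show ?thesis using h g by (auto simp: R_def)
qed

text \<open>On a line everything reduces to one element and its square. Otherwise the dimensions are
  (1, 1, 2), and the cases depend on whether squares from \<open>Eh\<close> have a component in
  \<open>E0\<close>.\<close>

lemma E0_defect:
  assumes x: "x \<in> E0" and v: "v \<in> E0"
  shows "jordan_defect (\<odot>) \<tau> x v = 0"
proof (cases "dim E0 \<le> 1")
  case True
  obtain e where e: "e \<in> E0" and E0: "\<And>z. z \<in> E0 \<Longrightarrow> \<exists>c. z = c *s e"
    using dim_le_1_ex[OF subspace_E0 True] by blast
  obtain c d r where "x = c *s e" "v = d *s e" "e \<odot> e = r *s e"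
    using E0 x v E0_E0[OF e e] by meson
  then show ?thesis by (simp add: jordan_defect_def mult_scale form_bilinear)
next
  case False
  then have dims: "dim E1 \<le> 1" "dim Eh \<le> 1" "dim E0 \<le> 2" "2 \<le> dim E0" "dim (UNIV :: 'b set) = 4"
    using dim_peirce dim_le_4 dim_E1_pos dim_Eh_pos by linarith+
  obtain b0 k0 h z0 where h: "b0 \<in> X" "b0 = k0 + h + z0" "k0 \<in> E1" "h \<in> Eh" "z0 \<in> E0" "h \<noteq> 0"
    by (rule ex_axis_half)
  have E1: "\<exists>l. k = l *s a" if k: "k \<in> E1" for k
    by (rule dim_le_1[OF subspace_E1 dims(1) a_E1 a_nonzero k]) blast
  have Eh: "\<exists>l. g = l *s h" if g: "g \<in> Eh" for g
    by (rule dim_le_1[OF subspace_Eh dims(2) h(4,6) g]) blast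
  have "\<forall>z\<in>E0. \<exists>c. z \<odot> h = c *s h" using Eh E0_Eh(1) h(4) by blast
  \<comment> \<open>\<open>\<phi> z\<close> is the eigenvalue of \<open>z\<close> on the line
    \<open>Eh\<close>; by \<open>E0_mult_act\<close>, twice \<open>\<phi>\<close> is
    multiplicative.\<close>
  then obtain \<phi> where \<phi>: "\<And>z. z \<in> E0 \<Longrightarrow> z \<odot> h = \<phi> z *s h" by metis
  have \<phi>_mult: "\<phi> (z \<odot> z') = \<phi> z * \<phi> z' + \<phi> z * \<phi> z'" if z: "z \<in> E0" "z' \<in> E0" for z z'
  proof -
    have "\<phi> (z \<odot> z') *s h = (\<phi> z * \<phi> z' + \<phi> z * \<phi> z') *s h"
      unfolding scale_left_distrib
      using E0_mult_act[OF z h(4)] z E0_E0[OF z] by (simp add: \<phi> mult_scale mult.commute)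
    then show ?thesis using h(6) scale_cancel_right by blast
  qed
  have \<phi>_lin: "\<phi> (c *s z + d *s z') = c * \<phi> z + d * \<phi> z'" if z: "z \<in> E0" "z' \<in> E0" for z z' c d
  proof -
    have "c *s z + d *s z' \<in> E0"
      using z subspace_add[OF subspace_E0] subspace_scale[OF subspace_E0] by blast
    then have "\<phi> (c *s z + d *s z') *s h = (c *s z + d *s z') \<odot> h" by (simp add: \<phi>)
    also have "\<dots> = (c * \<phi> z + d * \<phi> z') *s h"
      using z by (simp add: mult_add mult_scale \<phi> scale_left_distrib)
    finally show ?thesis using h(6) scale_cancel_right by blast
  qed
  define n where "n = h \<odot> h - a \<odot> (h \<odot> h)"
  define s where "s = \<tau> h h"
  have n: "n \<in> E0" using Eh_Eh(2)[OF h(4,4)] by (simp add: n_def)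
  \<comment> \<open>The vanishing of \<open>H z h h\<close> determines all pairings with
    \<open>n\<close>.\<close>
  have form_n: "\<tau> n z = \<phi> z * s + \<phi> z * s" if z: "z \<in> E0" for z
    using H_eq_0[OF z h(4,4)] form_E1[OF Eh_Eh(1)[OF h(4,4)]] z
    by (simp add: H_def n_def form_bilinear \<phi> s_def algebra_simps)
  have mult_n: "z \<odot> n = (\<phi> z + \<phi> z) *s n" if z: "z \<in> E0" for z
  proof -
    have "z \<odot> n = z \<odot> (h \<odot> h)"
      using E1_E0(2)[OF Eh_Eh(1)[OF h(4,4)] z] by (simp add: n_def mult_diff)
    then show ?thesis
      unfolding scale_left_distrib using E0_act_Eh_Eh[OF z h(4,4)] z
      by (simp add: \<phi> mult_scale n_def scale_right_diff_distrib)
  qed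
  show ?thesis
  proof (cases "n = 0")
    case False
    txt \<open>The line through \<open>n\<close> is an ideal of \<open>E0\<close> on which the form is a coboundary.\<close>
    obtain w where w: "w \<in> E0" "\<And>c. w \<noteq> c *s n" by (rule ex_not_multiple[OF dims(4)]) blast
    note basis = dim_le_2[OF subspace_E0 dims(3) n False w]
    obtain c d where x': "x = c *s n + d *s w" by (rule basis[OF x]) blast
    obtain c' d' where v': "v = c' *s n + d' *s w" by (rule basis[OF v]) blast
    obtain p q where ww: "w \<odot> w = p *s n + q *s w" by (rule basis[OF E0_E0[OF w(1,1)]]) blast
    define f where "f = \<phi> n + \<phi> n"
    define g where "g = \<phi> w + \<phi> w"
    \<comment> \<open>Multiplicativity of twice \<open>\<phi>\<close> at \<open>w \<odot> w\<close>;
      the defect vanishes as a polynomial modulo this relation.\<close>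
    have gg: "g * g = p * f + q * g"
      using \<phi>_mult[OF w(1,1)] \<phi>_lin[OF n w(1), of p q] unfolding f_def g_def ww by algebra
    have mult: "(r *s n + u *s w) \<odot> (r' *s n + u' *s w) =
        (r * r' * f + (r * u' + u * r') * g + u * u' * p) *s n + (u * u' * q) *s w" for r u r' u'
      using mult_n[OF n] mult_n[OF w(1)]
      by (simp add: mult_bilinear ww f_def[symmetric] g_def[symmetric] comm[of n w]
          scale_left_distrib scale_right_distrib algebra_simps)
    have form: "\<tau> (r *s n + u *s w) (r' *s n + u' *s w) =
        r * r' * f * s + (r * u' + u * r') * g * s + u * u' * \<tau> w w" for r u r' u'
      using form_n[OF n] form_n[OF w(1)] form_comm[of w n]
      by (simp add: form_bilinear f_def g_def algebra_simps)
    show ?thesis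
      unfolding jordan_defect_def x' v' mult form using gg by algebra
  next
    case True
    have hh: "h \<odot> h \<in> E1" using True Eh_Eh(1)[OF h(4,4)] by (simp add: n_def)
    \<comment> \<open>Squares of half components now stay in \<open>E1\<close>. Hence the
      \<open>E0\<close> component \<open>t\<close> of a generator is idempotent or zero and inherits
      the axis relation within \<open>E0\<close>.\<close>
    have X: "\<exists>l m t. b = l *s a + m *s h + t \<and> t \<in> E0 \<and> t \<odot> t = t
        \<and> (\<forall>w\<in>E0. \<forall>v\<in>E0. jordan_polar (\<odot>) \<tau> t t w v = 0)" if b: "b \<in> X" for b
    proof -
      obtain k g t where c: "b = k + g + t" "k \<in> E1" "g \<in> Eh" "t \<in> E0"
        "t \<odot> t + (g \<odot> g - a \<odot> (g \<odot> g)) = t"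
        using X_components[OF b] by metis
      obtain l where l: "k = l *s a" using E1 c by blast
      obtain m where m: "g = m *s h" using Eh c by blast
      have gg: "g \<odot> g - a \<odot> (g \<odot> g) = 0"
        using True by (simp add: m mult_scale n_def)
      then have tt: "t \<odot> t = t" using c(5) by simp
      have gE1: "g \<odot> g \<in> E1" using gg Eh_Eh(1)[OF c(3,3)] by simp
      have "jordan_polar (\<odot>) \<tau> t t w v = 0" if w: "w \<in> E0" and v: "v \<in> E0" for w v
      proof -
        have gw: "g \<odot> w = \<phi> w *s g" "g \<odot> v = \<phi> v *s g"
          using \<phi> w v by (simp_all add: m mult_scale comm[of h] mult.commute)
        have "jordan_polar (\<odot>) \<tau> g g w v = 0"
          using gw E1_E0[OF gE1] w v form_E1[OF gE1] form_E1
          by (simp add: jordan_polar_def mult_scale form_bilinear comm[of w g] comm[of v g] E0_E0)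
        moreover have "jordan_polar (\<odot>) \<tau> a t w v = 0"
          using c(4) w v by (simp add: form_polar_a_hom)
        moreover have "jordan_polar (\<odot>) \<tau> a g w v = 0"
          using c(3) w v fusion by (simp add: form_polar_a_hom form_orth)
        moreover have "jordan_polar (\<odot>) \<tau> t g w v = 0"
          using c(3,4) w v by (simp add: jordan_polar_def fusion form_orth)
        moreover have "jordan_polar (\<odot>) \<tau> (l *s a + g + t) (l *s a + g + t) w v = 0"
          using X_polar1[OF b] c(1) l by simp
        ultimately show ?thesis
          using polar_a form.polar_perm(1)[of g a] form.polar_perm(1)[of t a] form.polar_perm(1)[of g t]
          by (simp add: form.polar_add form_polar_scale)
      qed
      then show ?thesis using c(1,4) l m tt by blast
    qed
    obtain e where e: "h \<odot> h = e *s a" using E1 hh by blast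
    \<comment> \<open>Otherwise \<open>a\<close>, \<open>h\<close>, \<open>t\<close> would span a
      subalgebra containing \<open>X\<close>. Applying this to \<open>t = 0\<close> and then to the
      component found yields a basis of \<open>E0\<close>.\<close>
    have indep: "\<exists>b\<in>X. \<exists>l m t'. b = l *s a + m *s h + t' \<and> t' \<in> E0 \<and> t' \<odot> t' = t'
        \<and> (\<forall>w\<in>E0. \<forall>v\<in>E0. jordan_polar (\<odot>) \<tau> t' t' w v = 0) \<and> (\<forall>c. t' \<noteq> c *s t)"
      if t: "t \<in> E0" "t \<odot> t = t" for t
    proof (rule ccontr)
      assume not: "\<not> ?thesis"
      have "X \<subseteq> span {a, h, t}"
      proof
        fix b assume "b \<in> X"
        then obtain l m t' where "b = l *s a + m *s h + t'" "\<exists>c. t' = c *s t"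
          using X not by metis
        then show "b \<in> span {a, h, t}" by (auto simp: span_add span_scale_base)
      qed
      then have "dim (UNIV :: 'b set) \<le> card {a, h, t}"
        by (rule generates_dim_le[OF X_gen])
          (use h t \<phi>[OF t(1)] in \<open>auto simp: idem act e comm[of h t]
              span_zero span_base span_scale_base span_add\<close>)
      then show False using dims(5) card_le(1)[of a h t] by simp
    qed
    obtain t1 where t1: "t1 \<in> E0" "t1 \<odot> t1 = t1" "t1 \<noteq> 0"
        "\<And>w v. w \<in> E0 \<Longrightarrow> v \<in> E0 \<Longrightarrow> jordan_polar (\<odot>) \<tau> t1 t1 w v = 0"
      using indep[of 0] subspace_0[OF subspace_E0] by auto
    obtain t2 where t2: "t2 \<in> E0" "\<And>c. t2 \<noteq> c *s t1" "t2 \<odot> t2 = t2"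
        "\<And>w v. w \<in> E0 \<Longrightarrow> v \<in> E0 \<Longrightarrow> jordan_polar (\<odot>) \<tau> t2 t2 w v = 0"
      using indep[OF t1(1,2)] by blast
    obtain c d where x': "x = c *s t1 + d *s t2"
      by (rule dim_le_2[OF subspace_E0 dims(3) t1(1,3) t2(1,2) x]) blast
    \<comment> \<open>Symmetry of the form gives the defect at a multiple of an idempotent; the
      mixed terms of \<open>defect_add\<close> are the inherited relations.\<close>
    have "jordan_defect (\<odot>) \<tau> (c *s t) v = 0" if "t \<odot> t = t" for c t
      using that form_comm[of "t \<odot> v" t] by (simp add: jordan_defect_def mult_scale form_bilinear)
    then show ?thesis
      using t1 t2 v by (simp add: x' form.defect_add form_polar_scale)
  qed
qed

lemma defect_eq_0: "jordan_defect (\<odot>) \<tau> x z = 0"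
  using defect_eq_0I E1_adjoint H_eq_0 E0_defect by blast

end

section \<open>Reduction to normalised forms\<close>

lemma vector_space_field: "vector_space ((*) :: 'f::field \<Rightarrow> 'f \<Rightarrow> 'f)"
  by unfold_locales (simp_all add: algebra_simps)

lemma (in vector_space) ex_linear_functional:
  assumes "v \<noteq> 0"
  obtains f where "Vector_Spaces.linear scale (*) f" "f v \<noteq> 0"
proof -
  interpret pair: vector_space_pair scale "(*)"
    by (intro vector_space_pair.intro vector_space_axioms vector_space_field)
  have "independent {v}" using assms by simp
  then obtain g where "Vector_Spaces.linear scale (*) g" "\<forall>x\<in>{v}. g x = 1"
    using pair.linear_independent_extend[of "{v}" "\<lambda>_. 1"] by blast
  then show ?thesis using that[of g] by simp
qed

context jordan_algebra
begin

text \<open>All multiplications by generators are projections, so no half spaces occur. The defect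
  is then an instance of \<open>t u (v \<odot> w) = t (u \<odot> v) w\<close>.\<close>

lemma form_defect_eq_0_commuting:
  fixes t :: "'b \<Rightarrow> 'b \<Rightarrow> 'a"
  assumes t: "\<And>x y z. t (x + y) z = t x z + t y z" "\<And>c x z. t (c *s x) z = c * t x z"
      "\<And>x y. t x y = t y x"
    and polar: "\<And>b w y. b \<in> X \<Longrightarrow> jordan_polar (\<odot>) t b b w y = 0"
    and polar_mult: "\<And>x z w y. jordan_polar (\<odot>) (\<odot>) x z w y = 0"
    and idem: "\<And>b. b \<in> X \<Longrightarrow> b \<odot> b = b"
    and proj: "\<And>b x. b \<in> X \<Longrightarrow> b \<odot> (b \<odot> x) = b \<odot> x"
    and gen: "generates X"
  shows "jordan_defect (\<odot>) t x z = 0"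
proof -
  have comm: "x \<odot> y = y \<odot> x" for x y
    using commutative by (simp add: commutative_def)
  have t_right: "t z (x + y) = t z x + t z y" "t z (c *s x) = c * t z x" for x y z c
    using t by metis+
  have t_zero: "t 0 z = 0" "t z 0 = 0" for z
    using t(2)[of 0 0 z] t(3)[of z 0] by simp_all
  txt \<open>The elements whose multiplication is self-adjoint for both the product and the form form a
    subalgebra; it contains the generators because their multiplications are projections.\<close>
  let ?N = "{u. \<forall>v w. u \<odot> (v \<odot> w) = u \<odot> v \<odot> w \<and> t u (v \<odot> w) = t (u \<odot> v) w}"
  have "subspace ?N"
    by (auto simp: subspace_def mult_bilinear t t_right t_zero)
  moreover have "u \<odot> u' \<in> ?N" if "u \<in> ?N" "u' \<in> ?N" for u u'
    using that by auto metis+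
  ultimately have "subalgebra ?N"
    by (simp add: subalgebra_def)
  moreover have "b \<in> ?N" if b: "b \<in> X" for b
  proof -
    \<comment> \<open>The linearised identity at \<open>b \<odot> w\<close> gives \<open>b \<odot>
      (b \<odot> w \<odot> v) = b \<odot> w \<odot> (b \<odot> v)\<close>. Cancelling this in the
      identity at \<open>w\<close> leaves associativity; the form is treated likewise.\<close>
    have m: "b \<odot> (v \<odot> w) = b \<odot> v \<odot> w" for v w
    proof -
      have eq: "b \<odot> (b \<odot> w \<odot> y) + b \<odot> (b \<odot> w \<odot> y) + w \<odot> (b \<odot> y) =
          b \<odot> (w \<odot> y) + b \<odot> w \<odot> (b \<odot> y) + b \<odot> w \<odot> (b \<odot> y)" for w y
        using polar_mult[of b b w y] idem[OF b]
        by (simp add: jordan_polar_def comm algebra_simps)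
      have "b \<odot> (b \<odot> w \<odot> v) = b \<odot> w \<odot> (b \<odot> v)"
        using eq[of "b \<odot> w" v] proj[OF b, of w] by (simp add: algebra_simps)
      then have "w \<odot> (b \<odot> v) = b \<odot> (w \<odot> v)" using eq[of w v] by simp
      then show ?thesis by (simp add: comm)
    qed
    have eq: "t b (b \<odot> w \<odot> y) + t b (b \<odot> w \<odot> y) + t w (b \<odot> y) =
        t b (w \<odot> y) + t (b \<odot> w) (b \<odot> y) + t (b \<odot> w) (b \<odot> y)" for w y
      using polar[OF b, of w y] idem[OF b]
      by (simp add: jordan_polar_def comm t(3) algebra_simps)
    have "t b (v \<odot> w) = t (b \<odot> v) w" for v w
    proof -
      have "t b (b \<odot> w \<odot> v) = t (b \<odot> w) (b \<odot> v)"
        using eq[of "b \<odot> w" v] proj[OF b, of w] by (simp add: algebra_simps)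
      then have "t w (b \<odot> v) = t b (w \<odot> v)" using eq[of w v] by simp
      then show ?thesis by (simp add: comm t(3))
    qed
    then show ?thesis using m by blast
  qed
  ultimately have "subalgebra hull X \<subseteq> ?N"
    by (intro hull_minimal) auto
  then have N: "u \<in> ?N" for u
    using gen by (auto simp: generates_def)
  have "t (x \<odot> x \<odot> z) x = t (x \<odot> x) (z \<odot> x)" using N[of "x \<odot> x"] by simp
  then show ?thesis by (simp add: jordan_defect_def comm)
qed

text \<open>If some generator \<open>a\<close> has a half space, the coboundary
  \<open>f (x \<odot> y)\<close> is subtracted to bring \<open>a\<close> into the radical. Because
  the product is Jordan, this changes neither the polar form nor the defect.\<close>

lemma form_defect_eq_0:
  fixes t :: "'b \<Rightarrow> 'b \<Rightarrow> 'a"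
  assumes two: "(2::'a) \<noteq> 0"
    and fin: "finite_dim UNIV" and dim: "dim (UNIV :: 'b set) \<le> 4"
    and t: "\<And>x y z. t (x + y) z = t x z + t y z" "\<And>c x z. t (c *s x) z = c * t x z"
      "\<And>x y. t x y = t y x"
    and polar1: "\<And>b w y. b \<in> X \<Longrightarrow> jordan_polar (\<odot>) t b b w y = 0"
    and polar2: "\<And>b z w. b \<in> X \<Longrightarrow> jordan_polar (\<odot>) t b z w b = 0"
    and idems: "\<And>b. b \<in> X \<Longrightarrow> b \<odot> b = b"
    and gen: "generates X"
  shows "jordan_defect (\<odot>) t x z = 0"
proof -
  have half: "1/2 + 1/2 = (1::'a)" using two by (simp add: field_simps)
  have comm: "x \<odot> y = y \<odot> x" for x y
    using commutative by (simp add: commutative_def)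
  have t_right: "t z (x + y) = t z x + t z y" "t z (c *s x) = c * t z x" for x y z c
    using t by metis+
  txt \<open>The zero element only serves to reuse the linearised Jordan identity.\<close>
  interpret zero: peirce_jordan_algebra scale mult 0 "1/2"
    by unfold_locales (use half in simp_all)
  note polar_mult = zero.polar_mult_eq_0
  show ?thesis
  proof (cases "\<forall>b\<in>X. \<forall>x. b \<odot> (b \<odot> x) = b \<odot> x")
    case True
    then show ?thesis
      by (intro form_defect_eq_0_commuting[OF t polar1 polar_mult idems _ gen]) auto
  next
    case False
    then obtain a v where a: "a \<in> X" and v: "a \<odot> (a \<odot> v) \<noteq> a \<odot> v" by blast
    interpret peirce_jordan_algebra scale mult a "1/2"
      by unfold_locales (use half idems[OF a] in simp_all)
    txt \<open>The polynomial \<open>3 - 2 l\<close> inverts \<open>l\<close> at both non-zero eigenvalues, so \<open>\<tau>\<close> is orthogonal to \<open>a\<close>.\<close>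
    define f where "f x = 3 * t a x - 2 * t a (a \<odot> x)" for x
    define \<tau> where "\<tau> x y = t x y - f (x \<odot> y)" for x y
    have f: "f (x + y) = f x + f y" "f (c *s x) = c * f x" for x y c
      by (simp_all add: f_def mult_bilinear t_right algebra_simps)
    have f_diff: "f (x - y) = f x - f y" for x y
      using f(1)[of "x - y" y] by simp
    have polar: "jordan_polar (\<odot>) \<tau> x z w y = jordan_polar (\<odot>) t x z w y" for x z w y
    proof -
      have "jordan_polar (\<odot>) \<tau> x z w y =
          jordan_polar (\<odot>) t x z w y - f (jordan_polar (\<odot>) (\<odot>) x z w y)"
        by (simp add: jordan_polar_def \<tau>_def f f_diff)
      moreover have "f 0 = 0" using f_diff[of 0 0] by simp
      ultimately show ?thesis by (simp add: polar_mult)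
    qed
    have defect: "jordan_defect (\<odot>) \<tau> x z = jordan_defect (\<odot>) t x z" for x z
    proof -
      have "jordan_defect (\<odot>) \<tau> x z = jordan_defect (\<odot>) t x z
          - (f (x \<odot> x \<odot> z \<odot> x) - f (x \<odot> x \<odot> (x \<odot> z)))"
        by (simp add: jordan_defect_def \<tau>_def)
      moreover have "x \<odot> x \<odot> z \<odot> x = x \<odot> x \<odot> (x \<odot> z)"
        using jordan_identity[of x z] by (simp add: comm)
      ultimately show ?thesis by simp
    qed
    obtain B0 where B0: "finite B0" "span B0 = UNIV" using fin by (auto simp: finite_dim_def)
    obtain B where B: "B \<subseteq> B0" "independent B" "B0 \<subseteq> span B"
      using maximal_independent_subset[of B0] by blast
    have "span B = UNIV"
      using B0 B(3) span_minimal[of B0 "span B"] by auto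
    then interpret finite_dimensional_vector_space scale B
      by unfold_locales (use B B0 finite_subset in auto)
    interpret peirce_cocycle scale mult a "1/2" B \<tau> X
    proof unfold_locales
      show "\<tau> (x + y) z = \<tau> x z + \<tau> y z" for x y z
        by (simp add: \<tau>_def t(1) mult_add f)
      show "\<tau> (c *s x) z = c * \<tau> x z" for c x z
        by (simp add: \<tau>_def t(2) mult_scale f algebra_simps)
      show "\<tau> x y = \<tau> y x" for x y
        by (simp add: \<tau>_def t(3)[of x] comm[of x])
      \<comment> \<open>Unfolded, this is exactly the relation for \<open>t\<close> at
        \<open>a\<close>, \<open>a\<close>, \<open>x\<close>, \<open>a\<close>.\<close>
      show "\<tau> a x = 0" for x
        using polar1[OF a, of x a] idems[OF a]
        by (simp add: \<tau>_def f_def jordan_polar_def comm t(3) algebra_simps)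
      show "jordan_polar (\<odot>) \<tau> a a w y = 0" for w y
        by (simp add: polar polar1[OF a])
      show "\<exists>h\<in>Eh. h \<noteq> 0"
      proof (rule ccontr)
        assume "\<not> ?thesis"
        moreover obtain k h y where "v = k + h + y" "k \<in> E1" "h \<in> Eh" "y \<in> E0"
          by (rule peirce_decomposition)
        ultimately show False using v by (auto simp: mult_add act)
      qed
    qed (use idems polar polar1 polar2 gen dim in auto)
    show ?thesis using defect_eq_0 by (simp add: defect)
  qed
qed

end

section \<open>Central extensions\<close>

context central_extension
begin

lemma snd_ext_polar:
  "snd (jordan_polar ext_mult ext_mult p q r s) = jordan_polar mA \<theta> (fst p) (fst q) (fst r) (fst s)"
  by (simp add: jordan_polar_def ext_mult_def)

text \<open>These are the \<open>V\<close>-components of the relations satisfied by the lifted axis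
  in the extension.\<close>

lemma axis_polar_eq_0:
  assumes "J_half_axial_ext X" "(2::'f) \<noteq> 0" "b \<in> X"
  shows "jordan_polar mA \<theta> b b w y = 0" "jordan_polar mA \<theta> b z w b = 0"
proof -
  let ?b = "(b, \<theta> b b)"
  have axis: "ext.J_half_axis ?b" and comm: "ext.commutative"
    using assms by (auto simp: J_half_axial_ext_def ext.J_half_axial_def)
  note polar = ext.J_half_axis_polar_eq_0[OF axis assms(2) comm]
  show "jordan_polar mA \<theta> b b w y = 0" "jordan_polar mA \<theta> b z w b = 0"
    using snd_ext_polar[of ?b ?b "(w, 0)" "(y, 0)"] snd_ext_polar[of ?b "(z, 0)" "(w, 0)" ?b]
    by (simp_all add: polar)
qed

lemma jordan_algebra_ext:
  assumes "jordan_algebra sA mA" "\<And>x y. \<theta> x y = \<theta> y x" "\<And>x y. jordan_defect mA \<theta> x y = 0"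
  shows "jordan_algebra ext_scale ext_mult"
proof -
  interpret J: jordan_algebra sA mA by fact
  have comm: "mA x y = mA y x" for x y
    using J.commutative by (simp add: A.commutative_def)
  show ?thesis
  proof (intro jordan_algebra.intro jordan_algebra_axioms.intro ext.nonassoc_algebra_axioms)
    show "ext.commutative"
      by (auto simp: ext.commutative_def ext_mult_def comm assms(2))
    show "ext_mult (ext_mult p q) (ext_mult p p) = ext_mult p (ext_mult q (ext_mult p p))" for p q
      using J.jordan_identity[of "fst p" "fst q"] assms(3)[of "fst p" "fst q"]
      by (simp add: ext_mult_def jordan_defect_def comm assms(2))
  qed
qed

end

lemma two_neq_0_if_CHAR:
  assumes "CHAR('f::field) \<noteq> 2"
  shows "(2::'f) \<noteq> 0"
proof
  assume "(2::'f) = 0"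
  then have "of_nat 2 = (0::'f)" by simp
  then have "CHAR('f) dvd 2" by (simp only: of_nat_eq_0_iff_char_dvd)
  then have "CHAR('f) = 1 \<or> CHAR('f) = 2"
    using two_is_prime_nat by (auto simp: prime_nat_iff)
  then show False using assms of_nat_CHAR[where 'a = 'f] by auto
qed

theorem theorem3p10:
  fixes sA :: "'f::alg_closed_field \<Rightarrow> 'a::ab_group_add \<Rightarrow> 'a"
    and mA :: "'a \<Rightarrow> 'a \<Rightarrow> 'a"
    and sV :: "'f \<Rightarrow> 'v::ab_group_add \<Rightarrow> 'v"
    and \<theta> :: "'a \<Rightarrow> 'a \<Rightarrow> 'v"
    and X :: "'a set"
    and n :: nat
  assumes "CHAR('f) \<noteq> 2"
    and "axial_jordan_algebra sA mA"
    and "nonassoc_algebra.finite_dim sA (UNIV :: 'a set)"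
    and "vector_space.dim sA (UNIV :: 'a set) = n" and "n \<le> 4"
    and "nonassoc_algebra.idempotent_generators sA mA X"
    and "central_extension sA mA sV \<theta>"
    and "central_extension.J_half_axial_ext sA mA sV \<theta> X"
    and "\<not> central_extension.split sA mA sV \<theta>"
  shows "jordan_algebra (central_extension.ext_scale sA sV) (central_extension.ext_mult mA \<theta>)"
proof -
  interpret C: central_extension sA mA sV \<theta> by fact
  interpret J: axial_jordan_algebra sA mA by fact
  have two: "(2::'f) \<noteq> 0" by (rule two_neq_0_if_CHAR) fact
  have symm: "\<theta> x y = \<theta> y x" for x y
    using assms(8) by (simp add: C.J_half_axial_ext_def)
  have \<theta>: "\<theta> (x + y) z = \<theta> x z + \<theta> y z" "\<theta> (sA c x) z = sV c (\<theta> x z)" for x y z c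
    using C.theta.linear_left by (simp_all add: Vector_Spaces.linear_iff)
  have "jordan_defect mA \<theta> x y = 0" for x y
  proof (rule ccontr)
    assume "jordan_defect mA \<theta> x y \<noteq> 0"
    \<comment> \<open>A linear functional on \<open>V\<close> detects a non-zero defect, whatever
      the dimension of \<open>V\<close>; composing with it gives a scalar form satisfying the same
      relations.\<close>
    then obtain f where f: "Vector_Spaces.linear sV (*) f" "f (jordan_defect mA \<theta> x y) \<noteq> 0"
      by (rule C.theta.s3.ex_linear_functional)
    interpret f: Vector_Spaces.linear sV "(*)" f by (rule f(1))
    define t where "t u w = f (\<theta> u w)" for u w
    have polar: "jordan_polar mA t p q r s = f (jordan_polar mA \<theta> p q r s)" for p q r s
      by (simp add: jordan_polar_def t_def f.add f.diff)
    have "jordan_defect mA t x y = 0"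
    proof (rule J.form_defect_eq_0[OF two assms(3)])
      show "vector_space.dim sA (UNIV :: 'a set) \<le> 4" using assms(4,5) by simp
      show "t (u + v) w = t u w + t v w" "t (sA c u) w = c * t u w" "t u v = t v u" for u v w c
        by (simp_all add: t_def \<theta> f.add f.scale symm[of u v])
      show "b \<in> X \<Longrightarrow> jordan_polar mA t b b u v = 0" "b \<in> X \<Longrightarrow> jordan_polar mA t b u v b = 0"
        for b u v
        using C.axis_polar_eq_0[OF assms(8) two] by (simp_all add: polar f.zero)
      show "mA b b = b" if "b \<in> X" for b
        using assms(6) that by (simp add: C.A.idempotent_generators_def C.A.idempotent_def)
      show "C.A.generates X" using assms(6) by (simp add: C.A.idempotent_generators_def)
    qed
    moreover have "jordan_defect mA t x y = f (jordan_defect mA \<theta> x y)"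
      by (simp add: jordan_defect_def t_def f.diff)
    ultimately show False using f(2) by simp
  qed
  then show ?thesis
    using C.jordan_algebra_ext J.jordan_algebra_axioms symm by blast
qed

end
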